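(* Let $\mathfrak{g}$ be a finite-dimensional simple Lie algebra over $\mathbb{C}$ of rank $\ell$ with simple roots $\alpha_1,\dots,\alpha_\ell$ and Cartan matrix $C=(a_{ij})_{i,j=1}^{\ell}$, $a_{ij}=\alpha_i(H_j)$, where $H_j$ is the simple coroot of $\alpha_j$. Let $k$ be a positive integer, and define $A(\mathbf{n};q)=A(n_1,\dots,n_\ell;q)\in\mathbb{C}[[q]]$ for $\mathbf{n}=(n_1,\dots,n_\ell)\in\mathbb{Z}^\ell$ by $$\chi_{L(k,0)}(x_1,\dots,x_\ell;q)=\sum_{\mathbf{n}\in\mathbb{Z}^\ell}A(\mathbf{n};q)\,x_1^{n_1}\cdots x_\ell^{n_\ell}.$$ Then for all $\mathbf{n}=(n_1,\dots,n_\ell)\in\mathbb{Z}^\ell$ and $i=1,\dots,\ell$, $$A(\mathbf{n};q)=A\left(n_1,\dots,n_{i-1},n_i-\tfrac{2}{\langle\alpha_i,\alpha_i\rangle}k,n_{i+1},\dots,n_\ell;q\right)q^{-\frac{2}{\langle\alpha_i,\alpha_i\rangle}k+\sum_{m=1}^{\ell}a_{mi}n_m}.$$ In particular, when $\mathfrak{g}$ is simply-laced, $$A(\mathbf{n};q)=A(n_1,\dots,n_{i-1},n_i-k,n_{i+1},\dots,n_\ell;q)\,q^{-k+\sum_{j=1}^{\ell}a_{ji}n_j}.$$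
   Context: Fix a Cartan subalgebra $\mathfrak{h}$ of $\mathfrak{g}$ and let $\langle\cdot,\cdot\rangle$ be the normalized Killing form, with $\langle\alpha,\alpha\rangle=2$ for long roots $\alpha$ (the form on $\mathfrak{h}^*$ is the induced one). $E_i,F_i,H_i$ ($1\le i\le\ell$) are Chevalley generators. $H^{(1)},\dots,H^{(\ell)}\in\mathfrak{h}$ are the fundamental coweights, defined by $\alpha_i(H^{(j)})=\delta_{i,j}$. Each $\frac{2}{\langle\alpha_i,\alpha_i\rangle}$ is a positive integer. The untwisted affine Lie algebra is $\hat{\mathfrak{g}}=\mathfrak{g}\otimes\mathbb{C}[t,t^{-1}]\oplus\mathbb{C}c$ with $c$ central and $[a\otimes t^m,b\otimes t^n]=[a,b]\otimes t^{m+n}+m\langle a,b\rangle\delta_{m+n,0}c$. For $a\in\mathfrak{g}$, $n\in\mathbb{Z}$, $a(n)$ denotes the operator by which $a\otimes t^n$ acts on a $\hat{\mathfrak{g}}$-module. $L(k,0)$ is the irreducible highest weight $\hat{\mathfrak{g}}$-module of level $k$ ($c$ acts as $k$) generated by a vector $\mathbf{1}$ annihilated by $\mathfrak{g}\otimes\mathbb{C}[t]$. $L(0)$ is the Virasoro (Sugawara) degree operator on $L(k,0)$: it satisfies $[L(0),a(n)]=-n\,a(n)$ for $a\in\mathfrak{g}$, $n\in\mathbb{Z}$, and $L(0)\mathbf{1}=0$. The multi-parameter character is $$\chi_{L(k,0)}(x_1,\dots,x_\ell;q)=\mathrm{tr}_{L(k,0)}\,x_1^{H^{(1)}(0)}\cdots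 x_\ell^{H^{(\ell)}(0)}q^{L(0)},$$ i.e. the coefficient of $x_1^{n_1}\cdots x_\ell^{n_\ell}q^r$ is the (finite) dimension of the joint eigenspace on which $H^{(j)}(0)$ acts by $n_j$ for all $j$ and $L(0)$ acts by $r$; all these eigenvalues are integers, and those of $L(0)$ are nonnegative. The identities are equalities of formal Laurent series in $q$. "Simply-laced" means all roots of $\mathfrak{g}$ have the same length. *)

theory Defs
  imports
    Complex_Main
    "HOL-Computational_Algebra.Formal_Laurent_Series"
    "HOL-Library.Poly_Mapping"
    "HOL-Library.Product_Plus"
begin

section \<open>Lie algebras\<close>

locale lie_algebra = vector_space scale
  for scale :: "'a::field \<Rightarrow> 'g::ab_group_add \<Rightarrow> 'g" (infixr \<open>*s\<close> 75) +
  fixes bracket :: "'g \<Rightarrow> 'g \<Rightarrow> 'g"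
  assumes bracket_linear_left: "Vector_Spaces.linear scale scale (\<lambda>x. bracket x y)"
    and bracket_linear_right: "Vector_Spaces.linear scale scale (\<lambda>y. bracket x y)"
    and bracket_self: "bracket x x = 0"
    and jacobi: "bracket x (bracket y z) + bracket y (bracket z x) + bracket z (bracket x y) = 0"
begin

definition lie_ideal :: "'g set \<Rightarrow> bool" where
  "lie_ideal I \<longleftrightarrow> subspace I \<and> (\<forall>x. \<forall>y\<in>I. bracket x y \<in> I)"

definition lie_subalgebra :: "'g set \<Rightarrow> bool" where
  "lie_subalgebra S \<longleftrightarrow> subspace S \<and> (\<forall>x\<in>S. \<forall>y\<in>S. bracket x y \<in> S)"

primrec lower_central_series :: "'g set \<Rightarrow> nat \<Rightarrow> 'g set" where
  "lower_central_series S 0 = S"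
| "lower_central_series S (Suc n) = span {bracket x y |x y. x \<in> S \<and> y \<in> lower_central_series S n}"

definition nilpotent_subalgebra :: "'g set \<Rightarrow> bool" where
  "nilpotent_subalgebra S \<longleftrightarrow> lie_subalgebra S \<and> (\<exists>n. lower_central_series S n = {0})"

definition normalizer :: "'g set \<Rightarrow> 'g set" where
  "normalizer S = {x. \<forall>y\<in>S. bracket x y \<in> S}"

definition cartan_subalgebra :: "'g set \<Rightarrow> bool" where
  "cartan_subalgebra \<hh> \<longleftrightarrow> nilpotent_subalgebra \<hh> \<and> normalizer \<hh> = \<hh>"

definition endo_trace :: "('g \<Rightarrow> 'g) \<Rightarrow> 'a" where
  "endo_trace f =
    (let b = (SOME b. independent b \<and> span b = UNIV) in \<Sum>x\<in>b. representation b (f x) x)"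

definition killing_form :: "'g \<Rightarrow> 'g \<Rightarrow> 'a" where
  "killing_form x y = endo_trace (\<lambda>z. bracket x (bracket y z))"

text \<open>
  Elements of the dual space of a subspace \<open>\<hh>\<close> are represented by functions on the whole Lie algebra
  that are linear on \<open>\<hh>\<close> and vanish outside \<open>\<hh>\<close>, so that equal functionals are equal functions and
  the vector space operations are the pointwise ones.
\<close>

definition dual_space :: "'g set \<Rightarrow> ('g \<Rightarrow> 'a) set" where
  "dual_space \<hh> =
    {f. (\<forall>x\<in>\<hh>. \<forall>y\<in>\<hh>. f (x + y) = f x + f y) \<and> (\<forall>c. \<forall>x\<in>\<hh>. f (c *s x) = c * f x) \<and>
        (\<forall>x. x \<notin> \<hh> \<longrightarrow> f x = 0)}"

definition root_space :: "'g set \<Rightarrow> ('g \<Rightarrow> 'a) \<Rightarrow> 'g set" where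
  "root_space \<hh> \<beta> = {x. \<forall>y\<in>\<hh>. bracket y x = \<beta> y *s x}"

definition roots :: "'g set \<Rightarrow> ('g \<Rightarrow> 'a) set" where
  "roots \<hh> = {\<beta> \<in> dual_space \<hh>. \<beta> \<noteq> (\<lambda>_. 0) \<and> root_space \<hh> \<beta> \<noteq> {0}}"

text \<open>
  The simple roots form a basis of \<open>\<hh>\<close>'s dual space, so the index type has \<open>dim \<hh>\<close> (the rank) elements.
\<close>

definition simple_roots :: "'g set \<Rightarrow> ('i::finite \<Rightarrow> 'g \<Rightarrow> 'a) \<Rightarrow> bool" where
  "simple_roots \<hh> \<alpha> \<longleftrightarrow>
    (\<forall>i. \<alpha> i \<in> roots \<hh>) \<and>
    (\<forall>f\<in>dual_space \<hh>. \<exists>!c :: 'i \<Rightarrow> 'a. f = (\<lambda>x. \<Sum>i\<in>UNIV. c i * \<alpha> i x)) \<and>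
    (\<forall>\<beta>\<in>roots \<hh>. \<exists>m :: 'i \<Rightarrow> int.
        \<beta> = (\<lambda>x. \<Sum>i\<in>UNIV. of_int (m i) * \<alpha> i x) \<and> ((\<forall>i. 0 \<le> m i) \<or> (\<forall>i. m i \<le> 0)))"

text \<open>
  The element \<open>H i = [E i, F i]\<close> with \<open>\<alpha> i (H i) = 2\<close> is the simple coroot of \<open>\<alpha> i\<close>.
\<close>

definition chevalley_generators ::
  "'g set \<Rightarrow> ('i::finite \<Rightarrow> 'g \<Rightarrow> 'a) \<Rightarrow> ('i \<Rightarrow> 'g) \<Rightarrow> ('i \<Rightarrow> 'g) \<Rightarrow> ('i \<Rightarrow> 'g) \<Rightarrow> bool" where
  "chevalley_generators \<hh> \<alpha> E F H \<longleftrightarrow>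
    (\<forall>i. E i \<in> root_space \<hh> (\<alpha> i) \<and> F i \<in> root_space \<hh> (\<lambda>x. - \<alpha> i x) \<and>
         bracket (E i) (F i) = H i \<and> \<alpha> i (H i) = 2) \<and>
    (\<forall>S. lie_subalgebra S \<and> range E \<subseteq> S \<and> range F \<subseteq> S \<and> range H \<subseteq> S \<longrightarrow> S = UNIV)"

definition fundamental_coweights ::
  "'g set \<Rightarrow> ('i::finite \<Rightarrow> 'g \<Rightarrow> 'a) \<Rightarrow> ('i \<Rightarrow> 'g) \<Rightarrow> bool" where
  "fundamental_coweights \<hh> \<alpha> W \<longleftrightarrow>
    (\<forall>j. W j \<in> \<hh>) \<and> (\<forall>i j. \<alpha> i (W j) = (if i = j then 1 else 0))"

text \<open>
  The form on the dual space of \<open>\<hh>\<close> induced by a bilinear form \<open>B\<close> that is nondegenerate on \<open>\<hh>\<close>.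
\<close>

definition dual_vector :: "('g \<Rightarrow> 'g \<Rightarrow> 'a) \<Rightarrow> 'g set \<Rightarrow> ('g \<Rightarrow> 'a) \<Rightarrow> 'g" where
  "dual_vector B \<hh> \<beta> = (THE t. t \<in> \<hh> \<and> (\<forall>x\<in>\<hh>. B t x = \<beta> x))"

definition dual_form :: "('g \<Rightarrow> 'g \<Rightarrow> 'a) \<Rightarrow> 'g set \<Rightarrow> ('g \<Rightarrow> 'a) \<Rightarrow> ('g \<Rightarrow> 'a) \<Rightarrow> 'a" where
  "dual_form B \<hh> \<beta> \<gamma> = B (dual_vector B \<hh> \<beta>) (dual_vector B \<hh> \<gamma>)"

end

locale simple_lie_algebra = lie_algebra +
  assumes finite_dimensional: "\<exists>b. finite b \<and> span b = UNIV"
    and nonabelian: "\<exists>x y. bracket x y \<noteq> 0"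
    and ideal_trivial: "lie_ideal I \<Longrightarrow> I = {0} \<or> I = UNIV"

locale complex_lie_algebra = lie_algebra scale bracket
  for scale :: "complex \<Rightarrow> 'g::ab_group_add \<Rightarrow> 'g" and bracket
begin

text \<open>
  Squared root lengths with respect to the Killing form of a simple Lie algebra are positive real
  numbers; they are compared through their real parts.
\<close>

definition long_root :: "'g set \<Rightarrow> ('g \<Rightarrow> complex) \<Rightarrow> bool" where
  "long_root \<hh> \<beta> \<longleftrightarrow> \<beta> \<in> roots \<hh> \<and>
    (\<forall>\<gamma>\<in>roots \<hh>. Re (dual_form killing_form \<hh> \<gamma> \<gamma>) \<le> Re (dual_form killing_form \<hh> \<beta> \<beta>))"

definition normalized_killing_form :: "'g set \<Rightarrow> ('g \<Rightarrow> 'g \<Rightarrow> complex) \<Rightarrow> bool" where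
  "normalized_killing_form \<hh> B \<longleftrightarrow>
    (\<exists>c. B = (\<lambda>x y. c * killing_form x y)) \<and>
    (\<forall>\<beta>. long_root \<hh> \<beta> \<longrightarrow> dual_form B \<hh> \<beta> \<beta> = 2)"

definition simply_laced :: "('g \<Rightarrow> 'g \<Rightarrow> complex) \<Rightarrow> 'g set \<Rightarrow> bool" where
  "simply_laced B \<hh> \<longleftrightarrow>
    (\<forall>\<beta>\<in>roots \<hh>. \<forall>\<gamma>\<in>roots \<hh>. dual_form B \<hh> \<beta> \<beta> = dual_form B \<hh> \<gamma> \<gamma>)"

end

section \<open>Modules over Lie algebras\<close>

locale lie_module = lie_algebra scale bracket + M: vector_space scaleM
  for scale :: "'a::field \<Rightarrow> 'g::ab_group_add \<Rightarrow> 'g" and bracket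
    and scaleM :: "'a \<Rightarrow> 'v::ab_group_add \<Rightarrow> 'v" +
  fixes \<rho> :: "'g \<Rightarrow> 'v \<Rightarrow> 'v"
  assumes action_linear_left: "Vector_Spaces.linear scale scaleM (\<lambda>x. \<rho> x v)"
    and action_linear_right: "Vector_Spaces.linear scaleM scaleM (\<rho> x)"
    and action_bracket: "\<rho> (bracket x y) v = \<rho> x (\<rho> y v) - \<rho> y (\<rho> x v)"
begin

definition submodule :: "'v set \<Rightarrow> bool" where
  "submodule S \<longleftrightarrow> M.subspace S \<and> (\<forall>x. \<forall>v\<in>S. \<rho> x v \<in> S)"

definition irreducible_module :: bool where
  "irreducible_module \<longleftrightarrow> (\<exists>v::'v. v \<noteq> 0) \<and> (\<forall>S. submodule S \<longrightarrow> S = {0} \<or> S = UNIV)"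

definition generated_by :: "'v \<Rightarrow> bool" where
  "generated_by v \<longleftrightarrow> (\<forall>S. submodule S \<and> v \<in> S \<longrightarrow> S = UNIV)"

end

section \<open>The untwisted affine Lie algebra\<close>

text \<open>
  The pair \<open>(p, z)\<close> stands for \<open>\<Sum>m. lookup p m \<otimes> t\<^sup>m + z c\<close>.
\<close>

type_synonym 'g affine = "(int \<Rightarrow>\<^sub>0 'g) \<times> complex"

definition affine_scale ::
  "(complex \<Rightarrow> 'g::ab_group_add \<Rightarrow> 'g) \<Rightarrow> complex \<Rightarrow> 'g affine \<Rightarrow> 'g affine" where
  "affine_scale scale a = (\<lambda>(p, z). (Poly_Mapping.map (scale a) p, a * z))"

definition affine_bracket ::
  "('g::ab_group_add \<Rightarrow> 'g \<Rightarrow> 'g) \<Rightarrow> ('g \<Rightarrow> 'g \<Rightarrow> complex) \<Rightarrow> 'g affine \<Rightarrow> 'g affine \<Rightarrow> 'g affine" where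
  "affine_bracket bracket B = (\<lambda>(p, z) (q, w).
    (\<Sum>m\<in>Poly_Mapping.keys p. \<Sum>n\<in>Poly_Mapping.keys q.
        Poly_Mapping.single (m + n) (bracket (Poly_Mapping.lookup p m) (Poly_Mapping.lookup q n)),
     \<Sum>m\<in>Poly_Mapping.keys p. \<Sum>n\<in>Poly_Mapping.keys q.
        if m + n = 0 then of_int m * B (Poly_Mapping.lookup p m) (Poly_Mapping.lookup q n) else 0))"

definition loop_element :: "'g::ab_group_add \<Rightarrow> int \<Rightarrow> 'g affine" where
  "loop_element a n = (Poly_Mapping.single n a, 0)"

definition central_element :: "'g::ab_group_add affine" where
  "central_element = (0, 1)"

abbreviation mode :: "('g::ab_group_add affine \<Rightarrow> 'v \<Rightarrow> 'v) \<Rightarrow> 'g \<Rightarrow> int \<Rightarrow> 'v \<Rightarrow> 'v" where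
  "mode \<rho> a n \<equiv> \<rho> (loop_element a n)"

text \<open>
  The conditions determine the module up to isomorphism: it is \<open>L(k,0)\<close>, with generating vector \<open>vac\<close>.
\<close>

definition is_L_k_0 ::
  "(complex \<Rightarrow> 'g::ab_group_add \<Rightarrow> 'g) \<Rightarrow> ('g \<Rightarrow> 'g \<Rightarrow> 'g) \<Rightarrow> ('g \<Rightarrow> 'g \<Rightarrow> complex) \<Rightarrow> complex \<Rightarrow>
   (complex \<Rightarrow> 'v::ab_group_add \<Rightarrow> 'v) \<Rightarrow> ('g affine \<Rightarrow> 'v \<Rightarrow> 'v) \<Rightarrow> 'v \<Rightarrow> bool" where
  "is_L_k_0 scale bracket B k scaleM \<rho> vac \<longleftrightarrow>
    lie_module (affine_scale scale) (affine_bracket bracket B) scaleM \<rho> \<and>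
    lie_module.irreducible_module scaleM \<rho> \<and>
    lie_module.generated_by scaleM \<rho> vac \<and>
    (\<forall>v. \<rho> central_element v = scaleM k v) \<and>
    (\<forall>a. \<forall>n\<ge>0. mode \<rho> a n vac = 0)"

text \<open>
  \<open>D\<close> is the Sugawara operator \<open>L(0)\<close>; these conditions determine it, since the module is generated by \<open>vac\<close>.
\<close>

definition is_L0 ::
  "(complex \<Rightarrow> 'v::ab_group_add \<Rightarrow> 'v) \<Rightarrow> ('g::ab_group_add affine \<Rightarrow> 'v \<Rightarrow> 'v) \<Rightarrow> 'v \<Rightarrow>
   ('v \<Rightarrow> 'v) \<Rightarrow> bool" where
  "is_L0 scaleM \<rho> vac D \<longleftrightarrow>
    Vector_Spaces.linear scaleM scaleM D \<and> D vac = 0 \<and>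
    (\<forall>a n v. D (mode \<rho> a n v) - mode \<rho> a n (D v) = scaleM (- of_int n) (mode \<rho> a n v))"

text \<open>
  The multi-parameter character as a formal series in the \<open>x\<^sub>j\<close> with coefficients in \<open>\<complex>[[q]]\<close>:
  \<open>character scaleM \<rho> W D n\<close> is the coefficient of \<open>\<Prod>j. x\<^sub>j ^ n j\<close>, where the operators \<open>W j (0)\<close>
  and \<open>D\<close> give the exponents of \<open>x\<^sub>j\<close> and \<open>q\<close>.
\<close>

definition joint_eigenspace ::
  "(complex \<Rightarrow> 'v::ab_group_add \<Rightarrow> 'v) \<Rightarrow> ('g::ab_group_add affine \<Rightarrow> 'v \<Rightarrow> 'v) \<Rightarrow> ('i \<Rightarrow> 'g) \<Rightarrow>
   ('v \<Rightarrow> 'v) \<Rightarrow> ('i \<Rightarrow> int) \<Rightarrow> int \<Rightarrow> 'v set" where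
  "joint_eigenspace scaleM \<rho> W D n r =
    {v. (\<forall>j. mode \<rho> (W j) 0 v = scaleM (of_int (n j)) v) \<and> D v = scaleM (of_int r) v}"

definition character ::
  "(complex \<Rightarrow> 'v::ab_group_add \<Rightarrow> 'v) \<Rightarrow> ('g::ab_group_add affine \<Rightarrow> 'v \<Rightarrow> 'v) \<Rightarrow> ('i \<Rightarrow> 'g) \<Rightarrow>
   ('v \<Rightarrow> 'v) \<Rightarrow> ('i \<Rightarrow> int) \<Rightarrow> complex fps" where
  "character scaleM \<rho> W D n =
    Abs_fps (\<lambda>r. of_nat (vector_space.dim scaleM (joint_eigenspace scaleM \<rho> W D n (int r))))"

text \<open>
  The integer equal to a given complex number; only meaningful for integral arguments, such as the
  entries of a Cartan matrix and the numbers \<open>2 / \<langle>\<alpha> i, \<alpha> i\<rangle>\<close>.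
\<close>

definition the_int :: "complex \<Rightarrow> int" where
  "the_int z = (THE m. of_int m = z)"

lemma the_int_of_int [simp]: "the_int (of_int m) = m"
  by (simp add: the_int_def)

end

theory Submission
  imports Defs "HOL-Library.Function_Algebras"
begin

text \<open>
  Fix a simple root \<open>\<alpha> i\<close> and put \<open>d = 2 / \<langle>\<alpha> i, \<alpha> i\<rangle>\<close>, which equals \<open>\<langle>E i, F i\<rangle>\<close>. On \<open>L(k,0)\<close> there are two
  triples that satisfy the relations of the three-dimensional simple Lie algebra, namely
  \<open>E i (0), F i (0), H i (0)\<close> and \<open>E i (-1), F i (1), H i (0) - d k\<close>. All the raising and lowering operators
  are locally nilpotent, so opposite weight spaces of either triple have the same dimension. On the
  space \<open>V[n, r]\<close> where \<open>W j (0)\<close> acts by \<open>n j\<close> and \<open>L(0)\<close> by \<open>r\<close>, the operator \<open>H i (0)\<close> acts by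
  \<open>p = \<Sum>m. a m i * n m\<close>. The reflection of the second triple changes \<open>n i\<close> by \<open>d k - p\<close> and \<open>r\<close> by
  \<open>d k - p\<close>, and the one of the first triple then changes \<open>n i\<close> by \<open>p - 2 d k\<close>. The composite, a
  translation in the affine Weyl group, gives \<open>dim V[n, r] = dim V[n - d k \<alpha> i, r - p + d k]\<close>
  (\<open>dim_translation\<close>), which is the claimed identity coefficient by coefficient. It covers
  all integers \<open>r\<close> because \<open>L(0)\<close> has no negative eigenvalues (\<open>grade_negative\<close>).

  Local nilpotence is immediate for \<open>E i (0)\<close>, \<open>F i (0)\<close> and \<open>F i (1)\<close>: they kill the generating vector
  and are ad-nilpotent. The case of \<open>E i (-1)\<close> uses that the module is irreducible and that the level is a natural
  number. For a root vector \<open>e\<close> of a long root, \<open>e(-1)\<^bsup>k+1\<^esup> \<one>\<close> is killed by all \<open>b(s)\<close> with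
  \<open>s > 0\<close> (\<open>long_root_power_singular\<close>), and a vector of positive degree with this property generates a
  proper submodule, hence vanishes (\<open>singular_vector_zero\<close>). If \<open>\<alpha> i\<close> is short, then some long root
  \<open>\<gamma>\<close> has \<open>\<alpha> i (\<gamma>\<^sup>\<or>) = 1\<close> (\<open>long_or_adjacent_to_long\<close>); then \<open>E i (-1)\<close> is conjugate, by exponentials of
  \<open>E\<^sub>\<gamma>(-1)\<close> and \<open>F\<^sub>\<gamma>(1)\<close>, to the zero mode of a vector in the root space of \<open>\<alpha> i - \<gamma>\<close>
  (\<open>short_mode_nilpotent\<close>).

  The root theory that this needs is derived from the simple root system and the Chevalley generators:
  the coweights \<open>W j\<close> split the Lie algebra into joint eigenspaces with integral weights, and the Killing form
  restricted to the real span of the \<open>W j\<close> is a sum of squares. Nondegeneracy of the Killing form follows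
  from the normalization, since a form that is identically zero could not give a long root the squared
  length 2. The Cauchy-Schwarz inequality then bounds \<open>\<beta>(\<gamma>\<^sup>\<or>)\<close> for long \<open>\<gamma>\<close>
  (\<open>long_coroot_bound\<close>).
\<close>

section \<open>Linear algebra\<close>

context vector_space
begin

text \<open>
  Applying \<open>T j - wt b j\<close> to a vanishing sum removes the term of weight \<open>wt b\<close> and rescales the
  others; for each of them the factor is nonzero for a suitable \<open>j\<close>.
\<close>

lemma joint_eigenvectors_independent:
  fixes T :: "'j \<Rightarrow> 'b \<Rightarrow> 'b" and wt :: "'w \<Rightarrow> 'j \<Rightarrow> 'a"
  assumes lin: "\<And>j. Vector_Spaces.linear scale scale (T j)"
  assumes "finite A" and "inj_on wt A"
    and "\<And>a j. a \<in> A \<Longrightarrow> T j (v a) = scale (wt a j) (v a)"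
    and "(\<Sum>a\<in>A. v a) = 0" and "a \<in> A"
  shows "v a = 0"
  using assms(2-)
proof (induction A arbitrary: v a rule: finite_induct)
  case empty
  then show ?case by simp
next
  case (insert b A)
  have zero: "v a = 0" if "a \<in> A" for a
  proof -
    have "wt a \<noteq> wt b"
      using insert.prems(1) insert.hyps that by (auto simp: inj_on_def)
    then obtain j where j: "wt a j \<noteq> wt b j" by auto
    interpret T: Vector_Spaces.linear scale scale "T i" for i by (rule lin)
    have "(\<Sum>x\<in>A. scale (wt x j - wt b j) (v x)) = (\<Sum>x\<in>insert b A. scale (wt x j - wt b j) (v x))"
      using insert.hyps by simp
    also have "\<dots> = (\<Sum>x\<in>insert b A. T j (v x) - scale (wt b j) (v x))"
      using insert.prems(2) by (intro sum.cong refl) (simp add: scale_left_diff_distrib)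
    also have "\<dots> = T j (\<Sum>x\<in>insert b A. v x) - scale (wt b j) (\<Sum>x\<in>insert b A. v x)"
      by (simp only: T.sum scale_sum_right sum_subtractf)
    also have "\<dots> = 0" by (simp only: insert.prems(3) T.zero scale_zero_right diff_zero)
    finally have s: "(\<Sum>x\<in>A. scale (wt x j - wt b j) (v x)) = 0" .
    have "scale (wt a j - wt b j) (v a) = 0"
    proof (rule insert.IH[where v = "\<lambda>x. scale (wt x j - wt b j) (v x)"])
      show "inj_on wt A" using insert.prems(1) by (simp add: inj_on_def)
      show "T i (scale (wt x j - wt b j) (v x)) = scale (wt x i) (scale (wt x j - wt b j) (v x))"
        if "x \<in> A" for x i
        using insert.prems(2)[of x i] that by (simp add: T.scale mult.commute)
    qed (use s that in auto)
    with j show ?thesis by simp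
  qed
  then have "v b = 0" using insert.prems(3) insert.hyps by simp
  with zero show ?case using insert.prems(4) by auto
qed

text \<open>
  Both sides equal the same double sum over \<open>b \<times> b'\<close> of products of matrix entries. With \<open>g\<close> the
  identity this says that the trace is independent of the basis, with \<open>b = b'\<close> that it is cyclic.
\<close>

lemma trace_swap:
  assumes b: "finite b" "independent b" "span b = UNIV"
    and b': "finite b'" "independent b'" "span b' = UNIV"
    and f: "Vector_Spaces.linear scale scale f" and g: "Vector_Spaces.linear scale scale g"
  shows "(\<Sum>x\<in>b. representation b (f (g x)) x) = (\<Sum>y\<in>b'. representation b' (g (f y)) y)"
proof -
  have key: "(\<Sum>x\<in>b. representation b (f (g x)) x) =
      (\<Sum>x\<in>b. \<Sum>y\<in>b'. representation b' (g x) y * representation b (f y) x)"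
    if b: "finite b" "independent b" "span b = UNIV"
      and b': "finite b'" "independent b'" "span b' = UNIV"
      and f: "Vector_Spaces.linear scale scale f"
    for b b' :: "'b set" and f g
  proof (rule sum.cong[OF refl])
    fix x
    interpret f: Vector_Spaces.linear scale scale f by (rule f)
    have "f (g x) = f (\<Sum>y\<in>b'. scale (representation b' (g x) y) y)"
      using sum_representation_eq[OF b'(2) _ b'(1) order_refl, of "g x"] b' by simp
    also have "\<dots> = (\<Sum>y\<in>b'. scale (representation b' (g x) y) (f y))"
      by (simp add: f.sum f.scale)
    finally show "representation b (f (g x)) x =
      (\<Sum>y\<in>b'. representation b' (g x) y * representation b (f y) x)"
      using b by (simp add: representation_sum representation_scale)
  qed
  show ?thesis
    unfolding key[OF b b' f] key[OF b' b g]
    by (subst sum.swap) (simp add: mult.commute)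
qed

text \<open>
  Stated without finiteness of the dimensions: if one of the spaces is infinite-dimensional, then so is the
  other, and both dimensions are 0 by convention.
\<close>

lemma dim_eq_of_mutual_injections:
  assumes f: "Vector_Spaces.linear scale scale f" and g: "Vector_Spaces.linear scale scale g"
    and X: "subspace X" and Y: "subspace Y"
    and fX: "f ` X \<subseteq> Y" "\<And>x. x \<in> X \<Longrightarrow> f x = 0 \<Longrightarrow> x = 0"
    and gY: "g ` Y \<subseteq> X" "\<And>y. y \<in> Y \<Longrightarrow> g y = 0 \<Longrightarrow> y = 0"
  shows "dim X = dim Y"
proof -
  have bound: "finite b \<and> card b \<le> card b'"
    if f: "Vector_Spaces.linear scale scale f" and X: "subspace X"
      and fX: "f ` X \<subseteq> Y" "\<And>x. x \<in> X \<Longrightarrow> f x = 0 \<Longrightarrow> x = 0"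
      and b: "b \<subseteq> X" "independent b"  and b': "finite b'" "Y \<subseteq> span b'"
    for f X Y b b'
  proof -
    interpret f: Vector_Spaces.linear scale scale f by (rule f)
    have "span b \<subseteq> X" using b X by (simp add: span_minimal)
    then have inj: "inj_on f (span b)"
      using fX(2) by (subst f.inj_on_iff_eq_0[OF subspace_span]) auto
    then have "independent (f ` b)" by (rule f.independent_inj_on_image[OF b(2)])
    moreover have "f ` b \<subseteq> span b'" using b fX b' by blast
    ultimately have "finite (f ` b) \<and> card (f ` b) \<le> card b'"
      by (rule independent_span_bound[OF b'(1)])
    moreover have "inj_on f b" using inj span_superset by (rule inj_on_subset)
    ultimately show ?thesis by (simp add: finite_image_iff card_image)
  qed
  obtain b where b: "b \<subseteq> X" "independent b" "X \<subseteq> span b" "card b = dim X"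
    by (rule basis_exists)
  obtain b' where b': "b' \<subseteq> Y" "independent b'" "Y \<subseteq> span b'" "card b' = dim Y"
    by (rule basis_exists)
  have "finite b' \<Longrightarrow> finite b \<and> card b \<le> card b'"
    by (rule bound[OF f X fX b(1,2)]) (use b' in auto)
  moreover have "finite b \<Longrightarrow> finite b' \<and> card b' \<le> card b"
    by (rule bound[OF g Y gY b'(1,2)]) (use b in auto)
  ultimately have "card b = card b'"
    by (cases "finite b"; cases "finite b'") auto
  with b b' show ?thesis by simp
qed

lemma linear_iterate:
  assumes "Vector_Spaces.linear scale scale f"
  shows "Vector_Spaces.linear scale scale (f ^^ n)"
proof (induction n)
  case 0
  show ?case by (simp add: linear_id[unfolded id_def] id_def)
next
  case (Suc n)
  then show ?case using assms using Vector_Spaces.linear_compose[OF Suc.IH assms] by (simp add: comp_def)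
qed

lemma iterate_eq_0_mono:
  assumes f: "Vector_Spaces.linear scale scale f" and "(f ^^ N) v = 0" and "N \<le> M"
  shows "(f ^^ M) v = 0"
proof -
  interpret f: Vector_Spaces.linear scale scale "f ^^ n" for n by (rule linear_iterate[OF f])
  have "(f ^^ M) v = (f ^^ (M - N)) ((f ^^ N) v)"
    using assms(3) by (metis comp_apply funpow_add le_add_diff_inverse2)
  then show ?thesis using assms(2) f.zero by metis
qed

end

section \<open>Locally nilpotent actions of the three-dimensional simple Lie algebra\<close>

locale sl2_module = vector_space scale
  for scale :: "'a::field_char_0 \<Rightarrow> 'v::ab_group_add \<Rightarrow> 'v" (infixr \<open>*s\<close> 75) +
  fixes e f h :: "'v \<Rightarrow> 'v"
  assumes linear_e: "Vector_Spaces.linear scale scale e"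
    and linear_f: "Vector_Spaces.linear scale scale f"
    and linear_h: "Vector_Spaces.linear scale scale h"
    and ef: "e (f v) = f (e v) + h v"
    and he: "h (e v) = e (h v) + 2 *s e v"
    and hf: "h (f v) = f (h v) - 2 *s f v"
    and nilpotent_e: "\<exists>N. (e ^^ N) v = 0"
    and nilpotent_f: "\<exists>N. (f ^^ N) v = 0"
begin

sublocale e: Vector_Spaces.linear scale scale e by (rule linear_e)
sublocale f: Vector_Spaces.linear scale scale f by (rule linear_f)
sublocale h: Vector_Spaces.linear scale scale h by (rule linear_h)

lemma opposite: "sl2_module scale f e (\<lambda>v. - h v)"
proof unfold_locales
  show "- h (b1 + b2) = - h b1 + - h b2" for b1 b2 by (simp add: h.add)
  show "- h (r *s b) = r *s - h b" for r b by (simp add: h.scale)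
  show "f (e v) = e (f v) + - h v" for v by (simp add: ef)
  show "- h (f v) = f (- h v) + 2 *s f v" for v by (simp add: hf f.neg)
  show "- h (e v) = e (- h v) - 2 *s e v" for v by (simp add: he e.neg)
qed (auto simp: e.add e.scale f.add f.scale nilpotent_e nilpotent_f)

lemma weight_f_pow:
  assumes "h v = c *s v"
  shows "h ((f ^^ n) v) = (c - 2 * of_nat n) *s (f ^^ n) v"
proof (induction n)
  case (Suc n)
  have "h ((f ^^ Suc n) v) = (c - 2 * of_nat n) *s (f ^^ Suc n) v - 2 *s (f ^^ Suc n) v"
    by (simp add: hf Suc f.scale)
  also have "\<dots> = (c - 2 * of_nat (Suc n)) *s (f ^^ Suc n) v"
    by (subst scale_left_diff_distrib[symmetric]) (simp add: algebra_simps del: funpow.simps)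
  finally show ?case .
qed (use assms in simp)

lemma e_f_pow:
  assumes "h v = c *s v"
  shows "e ((f ^^ Suc n) v) = (f ^^ Suc n) (e v) + (of_nat (Suc n) * (c - of_nat n)) *s (f ^^ n) v"
proof (induction n)
  case 0
  show ?case by (simp add: ef assms)
next
  case (Suc n)
  have "e ((f ^^ Suc (Suc n)) v) = f (e ((f ^^ Suc n) v)) + h ((f ^^ Suc n) v)"
    by (simp add: ef)
  also have "\<dots> = (f ^^ Suc (Suc n)) (e v) +
      ((of_nat (Suc n) * (c - of_nat n)) + (c - 2 * of_nat (Suc n))) *s (f ^^ Suc n) v"
    unfolding Suc.IH weight_f_pow[OF assms]
    by (simp add: f.add f.scale scale_left_distrib add.assoc)
  also have "(of_nat (Suc n) * (c - of_nat n)) + (c - 2 * of_nat (Suc n)) =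
      of_nat (Suc (Suc n)) * (c - of_nat (Suc n))"
    by (simp add: algebra_simps)
  finally show ?case .
qed

text \<open>
  The last nonzero vector \<open>(f ^^ j) v\<close> of the string satisfies \<open>0 = e (f ((f ^^ j) v)) =
  (j + 1) (c - j) (f ^^ j) v\<close>.
\<close>

lemma highest_weight_nat:
  assumes "h v = c *s v" and "e v = 0" and "v \<noteq> 0" and "(f ^^ N) v = 0"
  shows "\<exists>j<N. c = of_nat j"
proof -
  define M where "M = (LEAST N. (f ^^ N) v = 0)"
  have M: "(f ^^ M) v = 0" unfolding M_def by (rule LeastI[of _ N]) (rule assms)
  have "M \<le> N" unfolding M_def by (rule Least_le) (rule assms)
  have "M \<noteq> 0" using M assms(3) by (metis funpow_0)
  then obtain j where j: "M = Suc j" using not0_implies_Suc by blast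
  interpret fs: Vector_Spaces.linear scale scale "f ^^ Suc j" by (rule linear_iterate[OF linear_f])
  have "(f ^^ j) v \<noteq> 0" using not_less_Least[of j "\<lambda>N. (f ^^ N) v = 0"] j M_def by auto
  moreover have "(of_nat (Suc j) * (c - of_nat j)) *s (f ^^ j) v = 0"
    using e_f_pow[OF assms(1), of j] unfolding M[unfolded j] assms(2) fs.zero e.zero
    by (simp only: add_0)
  ultimately have "of_nat (Suc j) * (c - of_nat j) = 0" by (simp only: scale_eq_0_iff) blast
  then have "c = of_nat j" by (simp del: of_nat_Suc)
  then show ?thesis using j \<open>M \<le> N\<close> by auto
qed

text \<open>
  Raising \<open>v\<close> as far as possible yields a highest weight vector, whose weight differs from \<open>c\<close> by an
  even integer.
\<close>

lemma weight_int:
  assumes "h v = c *s v" and "v \<noteq> 0"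
  shows "\<exists>z. c = of_int z"
proof -
  interpret op: sl2_module scale f e "\<lambda>v. - h v" by (rule opposite)
  obtain N where N: "(e ^^ N) v = 0" using nilpotent_e by blast
  define M where "M = (LEAST N. (e ^^ N) v = 0)"
  have M: "(e ^^ M) v = 0" unfolding M_def by (rule LeastI[of _ N]) (rule N)
  have "M \<noteq> 0" using M assms(2) by (metis funpow_0)
  then obtain j where j: "M = Suc j" using not0_implies_Suc by blast
  let ?u = "(e ^^ j) v"
  have u: "?u \<noteq> 0" using not_less_Least[of j "\<lambda>N. (e ^^ N) v = 0"] j M_def by auto
  have "- h ?u = (- c - 2 * of_nat j) *s ?u"
    by (rule op.weight_f_pow) (simp add: assms(1))
  also have "- c - 2 * of_nat j = - (c + 2 * of_nat j)" by simp
  finally have "- h ?u = - ((c + 2 * of_nat j) *s ?u)" by (simp only: scale_minus_left)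
  then have hu: "h ?u = (c + 2 * of_nat j) *s ?u"
    by (simp only: neg_equal_iff_equal)
  obtain N' where "(f ^^ N') ?u = 0" using nilpotent_f by blast
  with highest_weight_nat[OF hu _ u] M j obtain i where "c + 2 * of_nat j = of_nat i" by auto
  then have "c = of_int (int i - 2 * int j)" by (simp add: algebra_simps)
  then show ?thesis ..
qed

text \<open>
  This replaces complete reducibility. The induction is on the nilpotency order of \<open>e\<close> at \<open>v\<close>: the vector
  \<open>e v\<close> has weight \<open>m + 2\<close> and satisfies \<open>(f ^^ (m + 2)) (e v) = 0\<close>, so it vanishes, and then \<open>v\<close> is a
  highest weight vector of weight \<open>m\<close> whose string is too short.
\<close>

lemma f_pow_injective_on_weight_space:
  assumes "h v = of_nat m *s v" and "(f ^^ m) v = 0"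
  shows "v = 0"
proof -
  obtain p where "(e ^^ p) v = 0" using nilpotent_e by blast
  then show ?thesis using assms
  proof (induction p arbitrary: v m)
    case (Suc p)
    have "f 0 = 0" by (rule f.zero)
    then have f0: "f ((f ^^ m) v) = 0" "f (f ((f ^^ m) v)) = 0" using Suc.prems(3) by auto
    have "e v = 0"
    proof (rule Suc.IH)
      show "(e ^^ p) (e v) = 0" using Suc.prems(1) by (simp add: funpow_swap1)
      have "h (e v) = (of_nat m + 2) *s e v"
        by (simp add: he Suc.prems(2) e.scale scale_left_distrib)
      then show "h (e v) = of_nat (m + 2) *s e v" by simp
      show "(f ^^ (m + 2)) (e v) = 0"
        using e_f_pow[OF Suc.prems(2), of "m + 1"] f0 by (simp add: e.zero)
    qed
    then show ?case
      using highest_weight_nat[OF Suc.prems(2) _ _ Suc.prems(3)] by auto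
  qed simp
qed

lemma dim_opposite_weight_spaces:
  assumes X: "subspace X" "\<And>v. v \<in> X \<Longrightarrow> h v = of_nat m *s v" "(f ^^ m) ` X \<subseteq> Y"
    and Y: "subspace Y" "\<And>v. v \<in> Y \<Longrightarrow> h v = - of_nat m *s v" "(e ^^ m) ` Y \<subseteq> X"
  shows "dim X = dim Y"
proof -
  interpret op: sl2_module scale f e "\<lambda>v. - h v" by (rule opposite)
  show ?thesis
  proof (rule dim_eq_of_mutual_injections[of "f ^^ m" "e ^^ m"])
    show "x = 0" if "x \<in> X" "(f ^^ m) x = 0" for x
      using X(2)[OF that(1)] that(2) by (rule f_pow_injective_on_weight_space)
    show "y = 0" if "y \<in> Y" "(e ^^ m) y = 0" for y
    proof (rule op.f_pow_injective_on_weight_space[OF _ that(2)])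
      show "- h y = of_nat m *s y" using Y(2)[OF that(1)] by simp
    qed
  qed (use X Y in \<open>auto intro: linear_iterate linear_e linear_f\<close>)
qed

end

section \<open>Conjugation by exponentials of locally nilpotent operators\<close>

text \<open>
  The operator \<open>G = exp T\<close> satisfies \<open>G y = (y + z) G\<close>, so \<open>y + z\<close> is nilpotent on the range of \<open>G\<close>,
  which is everything: \<open>v - G v\<close> has smaller nilpotency order than \<open>v\<close>.
\<close>

lemma locally_nilpotent_conjugate:
  fixes scale :: "'a::field_char_0 \<Rightarrow> 'b::ab_group_add \<Rightarrow> 'b" and T y z :: "'b \<Rightarrow> 'b"
  assumes T: "Vector_Spaces.linear scale scale T"
    and y: "Vector_Spaces.linear scale scale y" and z: "Vector_Spaces.linear scale scale z"
    and nT: "\<And>v. \<exists>N. (T ^^ N) v = 0" and ny: "\<And>v. \<exists>N. (y ^^ N) v = 0"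
    and Ty: "\<And>v. T (y v) = y (T v) + z v" and Tz: "\<And>v. T (z v) = z (T v)"
  shows "\<exists>N. ((\<lambda>v. y v + z v) ^^ N) v = 0"
proof -
  interpret vector_space scale using T by (simp add: Vector_Spaces.linear_def)
  interpret T: Vector_Spaces.linear scale scale T by (rule T)
  interpret y: Vector_Spaces.linear scale scale y by (rule y)
  interpret z: Vector_Spaces.linear scale scale z by (rule z)
  interpret Tn: Vector_Spaces.linear scale scale "T ^^ n" for n by (rule linear_iterate[OF T])
  \<comment> \<open>The exponential series truncated at \<open>N\<close>, which is exact on the kernel of \<open>T ^^ N\<close>.\<close>
  define ex where "ex N v = (\<Sum>n<N. scale (inverse (fact n)) ((T ^^ n) v))" for N v
  define G where "G v = ex (LEAST N. (T ^^ N) v = 0) v" for v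
  note T_le = iterate_eq_0_mono[OF T]
  have ex_eq: "ex M v = ex N v" if "(T ^^ N) v = 0" "N \<le> M" for N M v
    unfolding ex_def
    by (rule sum.mono_neutral_right) (use that T_le in \<open>auto simp: not_less\<close>)
  have G: "G v = ex N v" if "(T ^^ N) v = 0" for N v
    unfolding G_def
    by (rule ex_eq[symmetric]) (auto intro: LeastI[of "\<lambda>N. (T ^^ N) v = 0", OF that] Least_le that)
  have Tny: "(T ^^ n) (y v) = y ((T ^^ n) v) + scale (of_nat n) (z ((T ^^ (n - 1)) v))" for n v
  proof (induction n)
    case (Suc n)
    have "T (z ((T ^^ (n - 1)) v)) = z ((T ^^ n) v)" if "n > 0"
      using that Tz by (cases n) auto
    then show ?case using Suc by (cases "n = 0") (auto simp: T.add T.scale Ty algebra_simps)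
  qed simp
  have GyN: "\<exists>N. (T ^^ N) v = 0 \<and> (T ^^ N) (y v) = 0" for v
  proof -
    obtain N M where "(T ^^ N) v = 0" "(T ^^ M) (y v) = 0" using nT by blast
    then show ?thesis by (intro exI[of _ "max N M"]) (auto intro: T_le)
  qed
  have Gy: "G (y v) = y (G v) + z (G v)" for v
  proof -
    obtain N where N: "(T ^^ N) v = 0" "(T ^^ N) (y v) = 0" using GyN by blast
    have N': "(T ^^ Suc N) v = 0" "(T ^^ Suc N) (y v) = 0" using N by (auto intro: T_le)
    have fct: "inverse (fact (Suc n)) * of_nat (Suc n) = (inverse (fact n) :: 'a)" for n
      by (simp add: field_simps del: of_nat_Suc)
    have "G (y v) = ex (Suc N) (y v)" by (rule G[OF N'(2)])
    also have "\<dots> = (\<Sum>n<Suc N. scale (inverse (fact n)) (y ((T ^^ n) v))) +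
      (\<Sum>n<Suc N. scale (inverse (fact n) * of_nat n) (z ((T ^^ (n - 1)) v)))"
      unfolding ex_def Tny by (simp only: scale_right_distrib sum.distrib scale_scale)
    also have "(\<Sum>n<Suc N. scale (inverse (fact n) * of_nat n) (z ((T ^^ (n - 1)) v))) =
      (\<Sum>n<N. scale (inverse (fact n)) (z ((T ^^ n) v)))"
      by (subst sum.lessThan_Suc_shift) (simp only: fct, simp)
    also have "\<dots> = z (G v)" unfolding G[OF N(1)] ex_def by (simp add: z.sum z.scale)
    also have "(\<Sum>n<Suc N. scale (inverse (fact n)) (y ((T ^^ n) v))) = y (G v)"
      unfolding G[OF N'(1)] ex_def by (simp add: y.sum y.scale y.add)
    finally show ?thesis .
  qed
  have Gyn: "((\<lambda>v. y v + z v) ^^ n) (G v) = G ((y ^^ n) v)" for n v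
    by (induction n) (auto simp: Gy)
  have surj: "\<exists>u. (T ^^ N) u = 0 \<and> v = G u" if "(T ^^ N) v = 0" for N v
    using that
  proof (induction N arbitrary: v)
    case 0
    then show ?case by (auto simp: G[of 0 0] ex_def)
  next
    case (Suc N)
    have add: "G (u + w) = G u + G w" if "(T ^^ Suc N) u = 0" "(T ^^ Suc N) w = 0" for u w
    proof -
      have "(T ^^ Suc N) (u + w) = 0" using that by (simp only: Tn.add add_0)
      then show ?thesis unfolding that[THEN G] G ex_def
        by (simp only: G ex_def Tn.add scale_right_distrib sum.distrib)
    qed
    have Gv: "G v = (\<Sum>n<N. scale (inverse (fact (Suc n))) ((T ^^ Suc n) v)) + v"
      unfolding G[OF Suc.prems] ex_def
      by (subst sum.lessThan_Suc_shift) simp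
    have "(T ^^ N) (v - G v) = - (\<Sum>n<N. scale (inverse (fact (Suc n))) ((T ^^ N) ((T ^^ Suc n) v)))"
      unfolding Gv by (simp only: diff_add_eq_diff_diff_swap diff_self diff_0 Tn.neg Tn.sum Tn.scale)
    also have "\<dots> = 0"
    proof -
      have "(T ^^ N) ((T ^^ Suc n) v) = 0" for n
        using T_le[OF Suc.prems, of "N + Suc n"] by (metis comp_apply funpow_add le_add1 add_Suc_right Suc_le_mono)
      then show ?thesis by simp
    qed
    finally obtain u where u: "(T ^^ N) u = 0" "v - G v = G u" using Suc.IH by blast
    have u': "(T ^^ Suc N) u = 0" using u(1) by (rule T_le) simp
    have "G (v + u) = v" using add[OF Suc.prems u'] u(2) by (metis add.commute diff_add_cancel)
    moreover have "(T ^^ Suc N) (v + u) = 0" by (simp only: Tn.add Suc.prems u' add_0)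
    ultimately show ?case by metis
  qed
  obtain N where "(T ^^ N) v = 0" using nT by blast
  then obtain u where u: "v = G u" using surj by blast
  obtain n where "(y ^^ n) u = 0" using ny by blast
  then have "((\<lambda>v. y v + z v) ^^ n) v = 0" unfolding u Gyn using G[of 0 0] by (simp add: ex_def)
  then show ?thesis ..
qed

section \<open>Brackets and traces\<close>

context lie_algebra
begin

lemma bracket_right_linear: "Vector_Spaces.linear scale scale (bracket x)"
  using bracket_linear_right[of x] .

interpretation L: Vector_Spaces.linear scale scale "\<lambda>x. bracket x y" for y
  by (rule bracket_linear_left)
interpretation R: Vector_Spaces.linear scale scale "bracket x" for x
  by (rule bracket_right_linear)

lemmas bracket_simps = L.add L.diff L.neg L.zero L.scale R.add R.diff R.neg R.zero R.scale
lemmas bracket_sum_left = L.sum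
lemmas bracket_sum_right = R.sum

lemma bracket_antisym: "bracket x y = - bracket y x"
proof -
  have "bracket x y + bracket y x = bracket (x + y) (x + y)"
    by (simp only: bracket_simps) (simp add: bracket_self)
  also have "\<dots> = 0" by (rule bracket_self)
  finally show ?thesis by (simp add: eq_neg_iff_add_eq_0)
qed

lemma bracket_derivation: "bracket x (bracket y z) = bracket (bracket x y) z + bracket y (bracket x z)"
  using jacobi[of x y z] bracket_antisym[of z x] bracket_antisym[of z "bracket x y"]
  by (simp add: bracket_simps algebra_simps)

lemma bracket_eigenvector:
  assumes "bracket y x = c *s x" and "bracket y x' = c' *s x'"
  shows "bracket y (bracket x x') = (c + c') *s bracket x x'"
  by (simp add: bracket_derivation[of y] assms bracket_simps scale_left_distrib)

end

context simple_lie_algebra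
begin

lemma independent_finite: "independent b \<Longrightarrow> finite b"
  using finite_dimensional independent_span_bound[of _ b] by auto

lemma endo_trace_basis:
  assumes f: "Vector_Spaces.linear scale scale f"
    and b: "independent b" "span b = UNIV"
  shows "endo_trace f = (\<Sum>x\<in>b. representation b (f x) x)"
proof -
  define b' where "b' = (SOME b. independent b \<and> span b = UNIV)"
  have b': "independent b' \<and> span b' = UNIV"
    unfolding b'_def by (rule someI[of _ b]) (use b in simp)
  have "Vector_Spaces.linear scale scale (\<lambda>x. x)" by (rule linear_id[unfolded id_def])
  from trace_swap[OF _ _ _ _ _ _ f this, of b' b] b b' show ?thesis
    by (simp add: endo_trace_def Let_def independent_finite flip: b'_def)
qed

lemma exists_basis: "\<exists>b. independent b \<and> span b = UNIV"
proof -
  obtain b where "independent b" "UNIV \<subseteq> span b" using maximal_independent_subset[of UNIV] by blast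
  then show ?thesis by blast
qed

lemma endo_trace_commute:
  assumes "Vector_Spaces.linear scale scale f" and "Vector_Spaces.linear scale scale g"
  shows "endo_trace (\<lambda>x. f (g x)) = endo_trace (\<lambda>x. g (f x))"
proof -
  obtain b where b: "independent b" "span b = UNIV" using exists_basis by blast
  have "Vector_Spaces.linear scale scale (\<lambda>x. f (g x))" "Vector_Spaces.linear scale scale (\<lambda>x. g (f x))"
    using Vector_Spaces.linear_compose[OF assms] Vector_Spaces.linear_compose[OF assms(2,1)]
    by (simp_all add: comp_def)
  then show ?thesis
    using trace_swap[OF _ _ _ _ _ _ assms, of b b] b
    by (simp add: endo_trace_basis[OF _ b] independent_finite)
qed

lemma endo_trace_linear:
  assumes f: "Vector_Spaces.linear scale scale f" and g: "Vector_Spaces.linear scale scale g"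
  shows "endo_trace (\<lambda>x. f x + g x) = endo_trace f + endo_trace g"
    and "endo_trace (\<lambda>x. c *s f x) = c * endo_trace f"
proof -
  obtain b where b: "independent b" "span b = UNIV" using exists_basis by blast
  interpret f: Vector_Spaces.linear scale scale f by (rule f)
  interpret g: Vector_Spaces.linear scale scale g by (rule g)
  have "Vector_Spaces.linear scale scale (\<lambda>x. f x + g x)"
    by unfold_locales (simp_all add: f.add g.add f.scale g.scale algebra_simps)
  then show "endo_trace (\<lambda>x. f x + g x) = endo_trace f + endo_trace g"
    using f g b by (simp add: endo_trace_basis[OF _ b] representation_add sum.distrib)
  have "Vector_Spaces.linear scale scale (\<lambda>x. c *s f x)"
    by unfold_locales (simp_all add: f.add f.scale algebra_simps)
  then show "endo_trace (\<lambda>x. c *s f x) = c * endo_trace f"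
    using f b by (simp add: endo_trace_basis[OF _ b] representation_scale sum_distrib_left)
qed

lemma linear_bracket_bracket: "Vector_Spaces.linear scale scale (\<lambda>z. bracket x (bracket y z))"
  using Vector_Spaces.linear_compose[OF bracket_right_linear bracket_right_linear]
  by (simp add: comp_def)

lemma killing_form_sym: "killing_form x y = killing_form y x"
  unfolding killing_form_def by (rule endo_trace_commute) (rule bracket_right_linear)+

lemma killing_form_add: "killing_form (x + y) z = killing_form x z + killing_form y z"
  unfolding killing_form_def bracket_simps
  by (rule endo_trace_linear) (rule linear_bracket_bracket)+

lemma killing_form_scale: "killing_form (c *s x) z = c * killing_form x z"
  unfolding killing_form_def bracket_simps
  by (rule endo_trace_linear) (rule linear_bracket_bracket)+

text \<open>
  Both sides are traces of differences of triple products that agree up to a cyclic permutation.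
\<close>

lemma killing_form_invariant: "killing_form (bracket x y) z = killing_form x (bracket y z)"
proof -
  let ?l = "Vector_Spaces.linear scale scale"
  have l3: "?l (\<lambda>u. bracket x (bracket y (bracket z u)))" for x y z
    using Vector_Spaces.linear_compose[OF linear_bracket_bracket bracket_right_linear]
    by (simp add: comp_def)
  have l3': "?l (\<lambda>u. - 1 *s bracket x (bracket y (bracket z u)))" for x y z
    by unfold_locales (simp_all add: bracket_simps)
  have "killing_form (bracket x y) z =
      endo_trace (\<lambda>u. bracket x (bracket y (bracket z u)) + - 1 *s bracket y (bracket x (bracket z u)))"
    unfolding killing_form_def using bracket_derivation[of x y]
    by (intro arg_cong[of _ _ endo_trace] ext) simp
  also have "\<dots> = endo_trace (\<lambda>u. bracket x (bracket y (bracket z u))) +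
      - 1 * endo_trace (\<lambda>u. bracket y (bracket x (bracket z u)))"
    by (simp only: endo_trace_linear(1)[OF l3 l3'] endo_trace_linear(2)[OF l3 l3])
  also have "endo_trace (\<lambda>u. bracket y (bracket x (bracket z u))) =
      endo_trace (\<lambda>u. bracket x (bracket z (bracket y u)))"
    by (rule endo_trace_commute) (rule bracket_right_linear linear_bracket_bracket)+
  also have "endo_trace (\<lambda>u. bracket x (bracket y (bracket z u))) + - 1 * \<dots> =
      endo_trace (\<lambda>u. bracket x (bracket y (bracket z u)) + - 1 *s bracket x (bracket z (bracket y u)))"
    by (simp only: endo_trace_linear(1)[OF l3 l3'] endo_trace_linear(2)[OF l3 l3])
  also have "\<dots> = killing_form x (bracket y z)"
    unfolding killing_form_def using bracket_derivation[of y z]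
    by (intro arg_cong[of _ _ endo_trace] ext) (simp add: bracket_simps)
  finally show ?thesis .
qed

lemma center_trivial:
  assumes "\<And>z. bracket x z = 0"
  shows "x = 0"
proof -
  have "lie_ideal {x. \<forall>z. bracket x z = 0}"
    unfolding lie_ideal_def subspace_def
  proof (intro conjI allI ballI impI)
    fix x y assume "y \<in> {x. \<forall>z. bracket x z = 0}"
    then have "bracket x y = 0" using bracket_antisym[of x y] by simp
    then show "bracket x y \<in> {x. \<forall>z. bracket x z = 0}" by (simp add: bracket_simps)
  qed (simp_all add: bracket_simps)
  then consider "{x. \<forall>z. bracket x z = 0} = {0}" | "{x. \<forall>z. bracket x z = 0} = UNIV"
    using ideal_trivial by blast
  then show ?thesis using assms nonabelian by cases auto
qed

end

section \<open>The root space decomposition\<close>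

locale cartan_data = simple_lie_algebra scale bracket
  for scale :: "complex \<Rightarrow> 'g::ab_group_add \<Rightarrow> 'g" (infixr \<open>*s\<close> 75)
    and bracket :: "'g \<Rightarrow> 'g \<Rightarrow> 'g" +
  fixes \<hh> :: "'g set" and \<alpha> :: "'i::finite \<Rightarrow> 'g \<Rightarrow> complex" and E F H W :: "'i \<Rightarrow> 'g"
  assumes cartan: "cartan_subalgebra \<hh>"
    and simple: "simple_roots \<hh> \<alpha>"
    and chevalley: "chevalley_generators \<hh> \<alpha> E F H"
    and coweights: "fundamental_coweights \<hh> \<alpha> W"
begin

sublocale complex_lie_algebra scale bracket by unfold_locales

definition weight_space :: "('i \<Rightarrow> int) \<Rightarrow> 'g set" where
  "weight_space n = {x. \<forall>j. bracket (W j) x = of_int (n j) *s x}"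

definition weight_value :: "('i \<Rightarrow> int) \<Rightarrow> 'g \<Rightarrow> complex" where
  "weight_value n y = (\<Sum>j\<in>UNIV. of_int (n j) * \<alpha> j y)"

definition simple_weight :: "'i \<Rightarrow> 'i \<Rightarrow> int" where
  "simple_weight i = (\<lambda>j. if j = i then 1 else 0)"

text \<open>
  A root is encoded by its integral coordinates in the basis of simple roots, so that root spaces become
  joint eigenspaces of the operators \<open>ad (W j)\<close>.
\<close>

definition root_weights :: "('i \<Rightarrow> int) set" where
  "root_weights = {n. n \<noteq> 0 \<and> weight_space n \<noteq> {0}}"

lemma weight_value_simps:
  "weight_value (n + m) y = weight_value n y + weight_value m y"
  "weight_value (n - m) y = weight_value n y - weight_value m y"
  "weight_value (- n) y = - weight_value n y"
  "weight_value 0 y = 0"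
  "weight_value (\<lambda>j. z * n j) y = of_int z * weight_value n y"
  by (simp_all add: weight_value_def sum.distrib algebra_simps sum_subtractf sum_negf sum_distrib_left)

lemma weight_value_simple [simp]: "weight_value (simple_weight i) y = \<alpha> i y"
  by (simp add: weight_value_def simple_weight_def if_distrib[of "\<lambda>x. of_int x * _"] cong: if_cong)

lemma simple_weight_nonzero: "simple_weight i \<noteq> 0"
proof
  assume "simple_weight i = 0"
  then have "simple_weight i i = 0" by simp
  then show False by (simp add: simple_weight_def)
qed

lemma subspace_cartan: "subspace \<hh>"
  using cartan by (simp add: cartan_subalgebra_def nilpotent_subalgebra_def lie_subalgebra_def)

lemma normalizer_cartan: "(\<And>y. y \<in> \<hh> \<Longrightarrow> bracket x y \<in> \<hh>) \<Longrightarrow> x \<in> \<hh>"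
  using cartan by (auto simp: cartan_subalgebra_def normalizer_def)

lemma coweight_cartan [simp]: "W j \<in> \<hh>"
  using coweights by (simp add: fundamental_coweights_def)

lemma alpha_coweight [simp]: "\<alpha> i (W j) = (if i = j then 1 else 0)"
  using coweights by (simp add: fundamental_coweights_def)

lemma weight_value_coweight [simp]: "weight_value n (W j) = of_int (n j)"
  by (simp add: weight_value_def if_distrib[of "\<lambda>x. _ * x"] cong: if_cong)

lemma alpha_dual_space: "\<alpha> i \<in> dual_space \<hh>"
  using simple by (auto simp: simple_roots_def roots_def)

lemma alpha_linear:
  "x \<in> \<hh> \<Longrightarrow> y \<in> \<hh> \<Longrightarrow> \<alpha> i (x + y) = \<alpha> i x + \<alpha> i y"
  "x \<in> \<hh> \<Longrightarrow> \<alpha> i (c *s x) = c * \<alpha> i x"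
  using alpha_dual_space[of i] by (auto simp: dual_space_def)

lemma weight_value_linear:
  "x \<in> \<hh> \<Longrightarrow> y \<in> \<hh> \<Longrightarrow> weight_value n (x + y) = weight_value n x + weight_value n y"
  "x \<in> \<hh> \<Longrightarrow> weight_value n (c *s x) = c * weight_value n x"
  by (simp_all add: weight_value_def alpha_linear sum.distrib algebra_simps sum_distrib_left)

lemma generator_brackets:
  "y \<in> \<hh> \<Longrightarrow> bracket y (E i) = \<alpha> i y *s E i"
  "y \<in> \<hh> \<Longrightarrow> bracket y (F i) = - \<alpha> i y *s F i"
  "bracket (E i) (F i) = H i" "\<alpha> i (H i) = 2"
  using chevalley by (simp_all add: chevalley_generators_def root_space_def)

lemma subalgebra_eq_UNIV:
  assumes "subspace S" and S: "\<And>x y. x \<in> S \<Longrightarrow> y \<in> S \<Longrightarrow> bracket x y \<in> S"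
    and "\<And>i. E i \<in> S" "\<And>i. F i \<in> S"
  shows "S = UNIV"
proof -
  have "H i \<in> S" for i using S[of "E i" "F i"] assms generator_brackets(3)[of i] by simp
  with assms chevalley show ?thesis
    unfolding chevalley_generators_def lie_subalgebra_def by (metis image_subsetI)
qed

lemma eq_0_if_commutes_with_generators:
  assumes "\<And>i. bracket x (E i) = 0" and "\<And>i. bracket x (F i) = 0"
  shows "x = 0"
proof (rule center_trivial)
  have "{z. bracket x z = 0} = UNIV"
    by (rule subalgebra_eq_UNIV)
      (auto simp: subspace_def assms bracket_simps bracket_derivation[of x])
  then show "bracket x z = 0" for z by auto
qed

lemma weight_spaceI: "(\<And>j. bracket (W j) x = of_int (n j) *s x) \<Longrightarrow> x \<in> weight_space n"
  by (simp add: weight_space_def)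

lemma generators_weight_space: "E i \<in> weight_space (simple_weight i)" "F i \<in> weight_space (- simple_weight i)"
  by (auto intro!: weight_spaceI simp: generator_brackets simple_weight_def)

lemma subspace_weight_space: "subspace (weight_space n)"
  by (auto simp: subspace_def weight_space_def bracket_simps algebra_simps)

lemma zero_weight_space [simp]: "0 \<in> weight_space n"
  using subspace_weight_space by (rule subspace_0)

lemma bracket_weight_space:
  assumes "x \<in> weight_space n" and "y \<in> weight_space m"
  shows "bracket x y \<in> weight_space (n + m)"
  using assms bracket_eigenvector by (auto simp: weight_space_def)

lemma span_weight_spaces: "span (\<Union>n. weight_space n) = UNIV"
proof (rule subalgebra_eq_UNIV)
  let ?U = "\<Union>n. weight_space n"
  show "E i \<in> span ?U" "F i \<in> span ?U" for i
    using generators_weight_space by (auto intro: span_base)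
  show "bracket x y \<in> span ?U" if x: "x \<in> span ?U" and y: "y \<in> span ?U" for x y
    using x
  proof (induction x rule: span_induct_alt)
    case base
    then show ?case by (simp add: bracket_simps span_zero)
  next
    case (step c x x')
    have "bracket x y \<in> span ?U"
      using y
    proof (induction y rule: span_induct_alt)
      case (step d y y')
      then have "bracket x y \<in> span ?U"
        using bracket_weight_space \<open>x \<in> ?U\<close> by (blast intro: span_base)
      then show ?case using step(2) by (simp only: bracket_simps) (intro span_add span_scale)
    qed (simp add: bracket_simps span_zero)
    then show ?case using step(2) by (simp only: bracket_simps) (intro span_add span_scale)
  qed
qed (rule subspace_span)

text \<open>
  The difference of the two sides is killed by all \<open>\<alpha> j\<close>, hence commutes with the Chevalley generators.
  So the coweights span \<open>\<hh>\<close>.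
\<close>

lemma cartan_expansion:
  assumes "y \<in> \<hh>"
  shows "y = (\<Sum>j\<in>UNIV. \<alpha> j y *s W j)"
proof -
  define z where "z = y + - 1 *s (\<Sum>j\<in>UNIV. \<alpha> j y *s W j)"
  have s: "(\<Sum>j\<in>A. \<alpha> j y *s W j) \<in> \<hh>" for A
    by (intro subspace_sum subspace_scale subspace_cartan) auto
  have sum: "\<alpha> i (\<Sum>j\<in>A. \<alpha> j y *s W j) = (\<Sum>j\<in>A. \<alpha> j y * \<alpha> i (W j))" if "finite A" for i A
    using that
  proof (induction A rule: finite_induct)
    case empty
    show ?case using alpha_linear(2)[of 0 i 0] subspace_0[OF subspace_cartan] by simp
  next
    case (insert j A)
    then show ?case
      using s[of A] subspace_scale[OF subspace_cartan coweight_cartan, of "\<alpha> j y" j]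
      by (simp add: alpha_linear del: alpha_coweight)
  qed
  have z: "z \<in> \<hh>" unfolding z_def using s assms subspace_cartan
    by (intro subspace_add subspace_scale) auto
  have "\<alpha> i z = 0" for i
    unfolding z_def using s assms subspace_cartan
    by (simp add: alpha_linear subspace_scale sum if_distrib[of "\<lambda>x. _ * x"] del: scale_minus_left cong: if_cong)
  then have "bracket z (E i) = 0" "bracket z (F i) = 0" for i
    by (simp_all add: generator_brackets z)
  then have "z = 0" by (rule eq_0_if_commutes_with_generators)
  then show ?thesis by (simp add: z_def)
qed

lemma bracket_cartan_weight:
  assumes "y \<in> \<hh>" and "x \<in> weight_space n"
  shows "bracket y x = weight_value n y *s x"
proof -
  have "bracket y x = (\<Sum>j\<in>UNIV. \<alpha> j y *s bracket (W j) x)"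
    by (subst cartan_expansion[OF assms(1)]) (simp only: bracket_sum_left bracket_simps)
  also have "\<dots> = weight_value n y *s x"
    using assms(2) by (simp add: weight_space_def weight_value_def scale_sum_left mult.commute)
  finally show ?thesis .
qed

text \<open>
  All elements of \<open>\<hh>\<close> act by scalars on the weight spaces, which span, so \<open>bracket y y'\<close> acts by
  zero and lies in the trivial centre.
\<close>

lemma cartan_commutative:
  assumes "y \<in> \<hh>" and "y' \<in> \<hh>"
  shows "bracket y y' = 0"
proof (rule center_trivial)
  fix z
  have "z \<in> span (\<Union>n. weight_space n)" by (simp add: span_weight_spaces)
  then show "bracket (bracket y y') z = 0"
  proof (induction z rule: span_induct_alt)
    case (step c x z)
    have "bracket (bracket y y') x = bracket y (bracket y' x) - bracket y' (bracket y x)"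
      using bracket_derivation[of y y' x] by simp
    then have "bracket (bracket y y') x = 0"
      using step(1) assms by (auto simp: bracket_cartan_weight bracket_simps)
    with step show ?case by (simp add: bracket_simps)
  qed (simp add: bracket_simps)
qed

text \<open>
  The self-normalizing property of a Cartan subalgebra enters here.
\<close>

lemma weight_space_0: "weight_space 0 = \<hh>"
proof (intro equalityI subsetI)
  fix x assume "x \<in> weight_space 0"
  then have "bracket x y = 0" if "y \<in> \<hh>" for y
    using that bracket_cartan_weight[OF that, of x 0] bracket_antisym[of x y]
    by (simp add: weight_value_simps)
  then show "x \<in> \<hh>" using subspace_0[OF subspace_cartan] normalizer_cartan[of x] by simp
qed (auto intro!: weight_spaceI simp: cartan_commutative)

lemma exists_weight_basis:
  "\<exists>b wt. finite b \<and> independent b \<and> span b = UNIV \<and> (\<forall>z\<in>b. z \<in> weight_space (wt z))"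
proof -
  obtain b where b: "b \<subseteq> (\<Union>n. weight_space n)" "independent b" "(\<Union>n. weight_space n) \<subseteq> span b"
    using maximal_independent_subset by blast
  have "span b = UNIV" using span_weight_spaces span_mono[OF b(3)] unfolding span_span by blast
  moreover from b(1) obtain wt where "\<forall>z\<in>b. z \<in> weight_space (wt z)" by (auto simp: subset_iff) metis
  ultimately show ?thesis using b(2) independent_finite by blast
qed

text \<open>
  A basis of weight vectors involves only finitely many weights, and a vector of any other weight would be a
  sum of eigenvectors with different eigenvalues.
\<close>

lemma finite_weights: "finite {n. weight_space n \<noteq> {0}}"
proof -
  obtain b wt where b: "finite b" "independent b" "span b = UNIV"
    and wt: "\<And>z. z \<in> b \<Longrightarrow> z \<in> weight_space (wt z)"
    using exists_weight_basis by blast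
  have "n \<in> wt ` b" if n: "weight_space n \<noteq> {0}" for n
  proof (rule ccontr)
    assume notin: "n \<notin> wt ` b"
    obtain x where x: "x \<in> weight_space n" "x \<noteq> 0"
      using n zero_weight_space[of n] by blast
    define v where "v m = (if m = n then - x else
      (\<Sum>z\<in>{z\<in>b. wt z = m}. representation b x z *s z))" for m
    have "v n = 0"
    proof (rule joint_eigenvectors_independent[where T = "\<lambda>j. bracket (W j)" and v = v
          and A = "insert n (wt ` b)" and wt = "\<lambda>m j. of_int (m j)"])
      show "inj_on (\<lambda>m j. (of_int (m j) :: complex)) (insert n (wt ` b))"
        by (auto simp: inj_on_def fun_eq_iff)
      show "bracket (W j) (v m) = of_int (m j) *s v m" for m j
        using wt x(1)
        by (auto simp: v_def bracket_simps bracket_sum_right weight_space_def scale_sum_right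
            mult.commute intro!: sum.cong)
      have "(\<Sum>m\<in>wt ` b. v m) = (\<Sum>m\<in>wt ` b. \<Sum>z\<in>{z\<in>b. wt z = m}. representation b x z *s z)"
        using notin by (intro sum.cong) (auto simp: v_def)
      also have "\<dots> = (\<Sum>z\<in>b. representation b x z *s z)"
        by (rule sum.image_gen[OF b(1), symmetric])
      also have "\<dots> = x" using sum_representation_eq[OF b(2) _ b(1) order_refl] b(3) by simp
      finally show "(\<Sum>m\<in>insert n (wt ` b). v m) = 0"
        using notin b(1) by (simp add: v_def)
    qed (use b bracket_right_linear in auto)
    then show False using x by (simp add: v_def)
  qed
  then have "{n. weight_space n \<noteq> {0}} \<subseteq> wt ` b" by blast
  then show ?thesis by (rule finite_subset) (simp add: b(1))
qed

lemma root_vector_ad_nilpotent: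
  assumes e: "e \<in> weight_space n" and n: "n \<noteq> 0"
  shows "\<exists>N. (bracket e ^^ N) x = 0"
proof -
  interpret e: Vector_Spaces.linear scale scale "bracket e ^^ N" for N
    by (intro linear_iterate bracket_right_linear)
  note mono = iterate_eq_0_mono[OF bracket_right_linear]
  have hom: "\<exists>N. (bracket e ^^ N) x = 0" if x: "x \<in> weight_space m" for x m
  proof -
    define w where "w N = (\<lambda>j. m j + int N * n j)" for N
    have "(bracket e ^^ N) x \<in> weight_space (w N)" for N
    proof (induction N)
      case (Suc N)
      have "n + w N = w (Suc N)" by (auto simp: w_def fun_eq_iff algebra_simps)
      with bracket_weight_space[OF e Suc] show ?case by simp
    qed (use x in \<open>simp add: w_def\<close>)
    moreover have "\<exists>N. weight_space (w N) = {0}"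
    proof (rule ccontr)
      assume "\<nexists>N. weight_space (w N) = {0}"
      then have "range w \<subseteq> {n. weight_space n \<noteq> {0}}" by blast
      then have "finite (range w)" using finite_weights by (rule finite_subset)
      moreover obtain j where "n j \<noteq> 0" using n by (auto simp: fun_eq_iff)
      then have "inj w" by (auto simp: inj_def w_def fun_eq_iff)
      ultimately show False using finite_imageD infinite_UNIV_nat by blast
    qed
    ultimately show ?thesis by blast
  qed
  have "x \<in> span (\<Union>n. weight_space n)" by (simp add: span_weight_spaces)
  then show ?thesis
  proof (induction x rule: span_induct_alt)
    case base
    then show ?case by (intro exI[of _ 0]) simp
  next
    case (step c x y)
    then obtain N M where "(bracket e ^^ N) x = 0" "(bracket e ^^ M) y = 0" using hom by blast
    then have "(bracket e ^^ max N M) x = 0" "(bracket e ^^ max N M) y = 0" by (auto intro: mono)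
    then show ?case by (intro exI[of _ "max N M"]) (simp add: e.add e.scale)
  qed
qed

lemma sl2_adjoint:
  assumes e: "e \<in> weight_space n" and f: "f \<in> weight_space (- n)" and n: "n \<noteq> 0"
    and h: "bracket e f = h" "weight_value n h = 2"
  shows "sl2_module scale (bracket e) (bracket f) (bracket h)"
proof -
  have "h \<in> \<hh>" using bracket_weight_space[OF e f] h by (simp add: weight_space_0)
  then have he: "bracket h e = 2 *s e" and hf: "bracket h f = - 2 *s f"
    using e f h by (simp_all add: bracket_cartan_weight weight_value_simps)
  show ?thesis
  proof unfold_locales
    show "bracket e (bracket f v) = bracket f (bracket e v) + bracket h v" for v
      by (simp add: bracket_derivation[of e f] h)
    show "bracket h (bracket e v) = bracket e (bracket h v) + 2 *s bracket e v" for v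
      by (simp add: bracket_derivation[of h e] he bracket_simps)
    show "bracket h (bracket f v) = bracket f (bracket h v) - 2 *s bracket f v" for v
      by (simp add: bracket_derivation[of h f] hf bracket_simps)
    show "\<exists>N. (bracket e ^^ N) v = 0" "\<exists>N. (bracket f ^^ N) v = 0" for v
      using root_vector_ad_nilpotent e f n by auto
  qed (simp_all add: bracket_simps)
qed

lemma root_space_weight_value: "root_space \<hh> (weight_value n) = weight_space n"
proof (intro equalityI subsetI)
  fix x assume "x \<in> root_space \<hh> (weight_value n)"
  then show "x \<in> weight_space n"
    by (auto simp: root_space_def intro!: weight_spaceI)
qed (auto simp: root_space_def bracket_cartan_weight)

lemma roots_eq: "roots \<hh> = weight_value ` root_weights"
proof (intro equalityI subsetI)
  fix \<beta> assume \<beta>: "\<beta> \<in> roots \<hh>"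
  then obtain n :: "'i \<Rightarrow> int" where "\<beta> = (\<lambda>x. \<Sum>i\<in>UNIV. of_int (n i) * \<alpha> i x)"
    using simple unfolding simple_roots_def by blast
  then have n: "\<beta> = weight_value n" by (simp add: weight_value_def fun_eq_iff)
  have \<beta>': "weight_value n \<in> dual_space \<hh> \<and> weight_value n \<noteq> (\<lambda>_. 0) \<and> weight_space n \<noteq> {0}"
    using \<beta> unfolding roots_def n mem_Collect_eq root_space_weight_value by blast
  have "n \<noteq> 0"
  proof
    assume "n = 0"
    then have "weight_value n = (\<lambda>_. 0)" by (simp add: weight_value_def fun_eq_iff)
    with \<beta>' show False by blast
  qed
  moreover have "weight_space n \<noteq> {0}" using \<beta>' by (elim conjE)
  ultimately have "n \<in> root_weights" unfolding root_weights_def by (intro CollectI conjI)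
  with n show "\<beta> \<in> weight_value ` root_weights" by blast
next
  fix \<beta> assume "\<beta> \<in> weight_value ` root_weights"
  then obtain n where n: "\<beta> = weight_value n" "n \<noteq> 0" "weight_space n \<noteq> {0}"
    by (auto simp: root_weights_def)
  obtain j where "n j \<noteq> 0" using n(2) by (auto simp: fun_eq_iff)
  then have "weight_value n (W j) \<noteq> 0" by simp
  then have "weight_value n \<noteq> (\<lambda>_. 0)" by metis
  moreover have "weight_value n \<in> dual_space \<hh>"
    using alpha_dual_space unfolding dual_space_def
    by (auto simp: weight_value_linear) (simp add: weight_value_def)
  ultimately show "\<beta> \<in> roots \<hh>"
    using n by (simp add: roots_def root_space_weight_value)
qed

lemma inj_weight_value: "weight_value n = weight_value m \<Longrightarrow> n = m"
proof
  fix j assume "weight_value n = weight_value m"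
  then have "weight_value n (W j) = weight_value m (W j)" by simp
  then show "n j = m j" by simp
qed

lemma finite_root_weights: "finite root_weights"
  using finite_weights by (rule finite_subset[rotated]) (auto simp: root_weights_def)

lemma simple_weight_root: "simple_weight i \<in> root_weights"
proof -
  have "weight_value (simple_weight i) \<in> roots \<hh>"
    using simple by (simp add: simple_roots_def weight_value_simple[abs_def])
  then show ?thesis using inj_weight_value by (auto simp: roots_eq)
qed

end

section \<open>The invariant form and root lengths\<close>

context cartan_data
begin

lemma killing_form_simps:
  "killing_form (x + y) z = killing_form x z + killing_form y z"
  "killing_form z (x + y) = killing_form z x + killing_form z y"
  "killing_form (c *s x) z = c * killing_form x z"
  "killing_form z (c *s x) = c * killing_form z x"
  "killing_form 0 z = 0" "killing_form z 0 = 0"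
proof -
  show r: "killing_form (x + y) z = killing_form x z + killing_form y z"
    "killing_form (c *s x) z = c * killing_form x z" for x y z c
    by (rule killing_form_add killing_form_scale)+
  show l: "killing_form z (x + y) = killing_form z x + killing_form z y"
    "killing_form z (c *s x) = c * killing_form z x" for x y z c
    unfolding killing_form_sym[of z] by (rule r)+
  show "killing_form 0 z = 0" "killing_form z 0 = 0" using r(2)[of 0 0] l(2)[of z 0 0] by simp_all
qed

lemma killing_form_sum_left: "killing_form (\<Sum>i\<in>A. f i) y = (\<Sum>i\<in>A. killing_form (f i) y)"
  by (induction A rule: infinite_finite_induct) (simp_all add: killing_form_simps)

text \<open>
  The trace form evaluated in a basis of weight vectors. It makes the form on \<open>real_cartan\<close> a sum of squares.
\<close>

lemma killing_form_cartan:
  "\<exists>b wt. finite b \<and> span b = UNIV \<and> (\<forall>z\<in>b. z \<in> weight_space (wt z)) \<and>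
    (\<forall>y\<in>\<hh>. \<forall>y'\<in>\<hh>. killing_form y y' = (\<Sum>z\<in>b. weight_value (wt z) y * weight_value (wt z) y'))"
proof -
  obtain b wt where b: "finite b" "independent b" "span b = UNIV"
    and wt: "\<And>z. z \<in> b \<Longrightarrow> z \<in> weight_space (wt z)"
    using exists_weight_basis by blast
  have "killing_form y y' = (\<Sum>z\<in>b. weight_value (wt z) y * weight_value (wt z) y')"
    if "y \<in> \<hh>" "y' \<in> \<hh>" for y y'
    unfolding killing_form_def endo_trace_basis[OF linear_bracket_bracket b(2,3)]
  proof (rule sum.cong[OF refl])
    fix z assume z: "z \<in> b"
    have "bracket y (bracket y' z) = (weight_value (wt z) y * weight_value (wt z) y') *s z"
      using wt[OF z] that by (simp add: bracket_cartan_weight bracket_simps mult.commute)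
    then show "representation b (bracket y (bracket y' z)) z = weight_value (wt z) y * weight_value (wt z) y'"
      using b z by (simp add: representation_scale representation_basis)
  qed
  with b wt show ?thesis by blast
qed

text \<open>
  The real span of the coweights \<open>W j\<close>.
\<close>

definition real_cartan :: "'g set" where
  "real_cartan = {y \<in> \<hh>. \<forall>j. \<alpha> j y \<in> \<real>}"

lemma real_cartan_simps:
  "x \<in> real_cartan \<Longrightarrow> y \<in> real_cartan \<Longrightarrow> x + y \<in> real_cartan"
  "x \<in> real_cartan \<Longrightarrow> c \<in> \<real> \<Longrightarrow> c *s x \<in> real_cartan"
  "x \<in> real_cartan \<Longrightarrow> x \<in> \<hh>" "W j \<in> real_cartan"
  using subspace_cartan by (auto simp: real_cartan_def alpha_linear subspace_add subspace_scale)

lemma weight_value_real: "y \<in> real_cartan \<Longrightarrow> weight_value n y \<in> \<real>"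
  by (auto simp: weight_value_def real_cartan_def intro!: sum_in_Reals)

lemma killing_form_real:
  assumes "x \<in> real_cartan" and "y \<in> real_cartan"
  shows "killing_form x y \<in> \<real>"
proof -
  obtain b :: "'g set" and wt where
    "killing_form x y = (\<Sum>z\<in>b. weight_value (wt z) x * weight_value (wt z) y)"
    using killing_form_cartan assms real_cartan_simps(3) by blast
  then show ?thesis using assms by (auto intro!: sum_in_Reals Reals_mult weight_value_real)
qed

lemma killing_form_positive:
  assumes x: "x \<in> real_cartan" "x \<noteq> 0"
  shows "Re (killing_form x x) > 0"
proof -
  obtain b wt where b: "finite b" "span b = UNIV" and wt: "\<forall>z\<in>b. z \<in> weight_space (wt z)"
    and k: "\<forall>y\<in>\<hh>. \<forall>y'\<in>\<hh>. killing_form y y' = (\<Sum>z\<in>b. weight_value (wt z) y * weight_value (wt z) y')"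
    using killing_form_cartan by blast
  have xh: "x \<in> \<hh>" using x real_cartan_simps by blast
  have re: "Re (weight_value n x * weight_value n x) = (Re (weight_value n x))\<^sup>2" for n
    using weight_value_real[OF x(1), of n] by (simp add: power2_eq_square complex_is_Real_iff)
  have "\<exists>z\<in>b. weight_value (wt z) x \<noteq> 0"
  proof (rule ccontr)
    assume "\<not> (\<exists>z\<in>b. weight_value (wt z) x \<noteq> 0)"
    then have 0: "bracket x z = 0" if "z \<in> b" for z
      using that wt bracket_cartan_weight[OF xh, of z "wt z"] by auto
    have "bracket x z = 0" for z
    proof -
      have "z \<in> span b" by (simp add: b)
      then show ?thesis
        by (induction z rule: span_induct_alt) (simp_all add: bracket_simps 0)
    qed
    then have "x = 0" by (rule center_trivial)
    with x show False by simp
  qed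
  then obtain z where z: "z \<in> b" "Re (weight_value (wt z) x) \<noteq> 0"
    using weight_value_real[OF x(1)] by (auto simp: complex_is_Real_iff complex_eq_iff)
  have "Re (killing_form x x) = (\<Sum>z\<in>b. (Re (weight_value (wt z) x))\<^sup>2)"
    using k xh by (simp only: Re_sum re)
  also have "\<dots> > 0" using b(1) z by (intro sum_pos2[of b z]) auto
  finally show ?thesis .
qed

end

locale normalized_cartan_data = cartan_data scale bracket \<hh> \<alpha> E F H W
  for scale :: "complex \<Rightarrow> 'g::ab_group_add \<Rightarrow> 'g" (infixr \<open>*s\<close> 75)
    and bracket :: "'g \<Rightarrow> 'g \<Rightarrow> 'g"
    and \<hh> :: "'g set" and \<alpha> :: "'i::finite \<Rightarrow> 'g \<Rightarrow> complex" and E F H W :: "'i \<Rightarrow> 'g" +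
  fixes B :: "'g \<Rightarrow> 'g \<Rightarrow> complex"
  assumes normalized: "normalized_killing_form \<hh> B"
begin

definition form_factor :: complex where
  "form_factor = (SOME c. B = (\<lambda>x y. c * killing_form x y))"

lemma form_eq: "B x y = form_factor * killing_form x y"
proof -
  have "\<exists>c. B = (\<lambda>x y. c * killing_form x y)"
    using normalized unfolding normalized_killing_form_def by (rule conjunct1)
  from someI_ex[OF this] have "B = (\<lambda>x y. form_factor * killing_form x y)"
    unfolding form_factor_def .
  then show ?thesis by metis
qed

lemma form_simps:
  "B (x + y) z = B x z + B y z" "B z (x + y) = B z x + B z y"
  "B (c *s x) z = c * B x z" "B z (c *s x) = c * B z x" "B 0 z = 0" "B z 0 = 0"
  by (simp_all add: form_eq killing_form_simps algebra_simps)

lemma form_minus: "B (- x) z = - B x z" "B z (- x) = - B z x"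
  using form_simps(3)[of "-1" x z] form_simps(4)[of z "-1" x] by simp_all

lemma form_diff: "B (x - y) z = B x z - B y z" "B z (x - y) = B z x - B z y"
  using form_simps(1)[of x "- y" z] form_simps(2)[of z x "- y"] by (simp_all add: form_minus)

lemma form_sym: "B x y = B y x"
  by (simp add: form_eq killing_form_sym)

lemma form_invariant: "B (bracket x y) z = B x (bracket y z)"
  by (simp add: form_eq killing_form_invariant)

text \<open>
  There are finitely many roots, and at least one because the index type of the simple roots is nonempty.
\<close>

lemma exists_long_root: "\<exists>n\<in>root_weights. long_root \<hh> (weight_value n)"
proof -
  let ?L = "\<lambda>n. Re (dual_form killing_form \<hh> (weight_value n) (weight_value n))"
  have fin: "finite (?L ` root_weights)" "?L ` root_weights \<noteq> {}"
    using finite_root_weights simple_weight_root by auto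
  obtain n where n: "n \<in> root_weights" "?L n = Max (?L ` root_weights)"
    using Max_in[OF fin] by auto
  have "?L m \<le> ?L n" if "m \<in> root_weights" for m
    unfolding n using fin that by auto
  then show ?thesis using n(1) by (intro bexI[of _ n]) (auto simp: long_root_def roots_eq)
qed

lemma killing_form_nonzero: "\<exists>x y. killing_form x y \<noteq> 0" and form_factor_nonzero: "form_factor \<noteq> 0"
proof -
  obtain n where "long_root \<hh> (weight_value n)" using exists_long_root by blast
  then have "dual_form B \<hh> (weight_value n) (weight_value n) = 2"
    using normalized by (simp add: normalized_killing_form_def)
  then have "\<exists>x y. form_factor * killing_form x y \<noteq> 0"
    unfolding dual_form_def by (metis form_eq zero_neq_numeral)
  then show "\<exists>x y. killing_form x y \<noteq> 0" "form_factor \<noteq> 0" by auto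
qed

text \<open>
  The radical of the Killing form is an ideal, and it is not everything.
\<close>

lemma form_nondegenerate:
  assumes "\<And>y. B x y = 0"
  shows "x = 0"
proof -
  let ?R = "{x. \<forall>y. killing_form x y = 0}"
  have "lie_ideal ?R"
    unfolding lie_ideal_def subspace_def
  proof (intro conjI allI ballI impI)
    fix x y assume "y \<in> ?R"
    then have "killing_form (bracket y x) z = 0" for z by (simp add: killing_form_invariant)
    then have "killing_form (- 1 *s bracket y x) z = 0" for z by (simp only: killing_form_simps) simp
    then show "bracket x y \<in> ?R" using bracket_antisym[of x y] by simp
  qed (simp_all add: killing_form_simps)
  then have "?R = {0} \<or> ?R = UNIV" by (rule ideal_trivial)
  moreover have "?R \<noteq> UNIV" using killing_form_nonzero by blast
  moreover have "x \<in> ?R" using assms form_factor_nonzero by (simp add: form_eq)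
  ultimately show ?thesis by blast
qed

lemma form_orthogonal:
  assumes x: "x \<in> weight_space n" and y: "y \<in> weight_space m" and nm: "n + m \<noteq> 0"
  shows "B x y = 0"
proof -
  obtain j where j: "n j + m j \<noteq> 0" using nm by (auto simp: fun_eq_iff)
  have "bracket x (W j) = - of_int (n j) *s x"
    using x bracket_antisym[of x "W j"] by (simp add: weight_space_def)
  then have "- of_int (n j) * B x y = of_int (m j) * B x y"
    using form_invariant[of x "W j" y] y by (simp add: weight_space_def form_simps form_minus)
  then have "of_int (m j) * B x y - (- of_int (n j) * B x y) = 0" by simp
  then have "of_int (n j + m j) * B x y = 0" by (simp add: algebra_simps)
  with j show ?thesis by (simp only: mult_eq_0_iff of_int_eq_0_iff) blast
qed

lemma dual_weight_vector:
  assumes x: "x \<in> weight_space n" and "x \<noteq> 0"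
  shows "\<exists>y\<in>weight_space (- n). B x y = 1"
proof -
  have "\<exists>y\<in>weight_space (- n). B x y \<noteq> 0"
  proof (rule ccontr)
    assume "\<not> (\<exists>y\<in>weight_space (- n). B x y \<noteq> 0)"
    then have 0: "B x y = 0" if "y \<in> weight_space m" for y m
      using that form_orthogonal[OF x, of y m] by (cases "m = - n") (auto simp: add_eq_0_iff)
    have "B x y = 0" for y
    proof -
      have "y \<in> span (\<Union>n. weight_space n)" by (simp add: span_weight_spaces)
      then show ?thesis
        by (induction y rule: span_induct_alt) (auto simp: form_simps 0)
    qed
    then have "x = 0" by (rule form_nondegenerate)
    with assms show False by simp
  qed
  then obtain y where y: "y \<in> weight_space (- n)" "B x y \<noteq> 0" by blast
  then have "inverse (B x y) *s y \<in> weight_space (- n)" "B x (inverse (B x y) *s y) = 1"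
    by (simp_all add: form_simps subspace_scale[OF subspace_weight_space])
  then show ?thesis by blast
qed

lemma form_nondegenerate_cartan:
  assumes x: "x \<in> \<hh>" and 0: "\<And>y. y \<in> \<hh> \<Longrightarrow> B x y = 0"
  shows "x = 0"
proof (rule ccontr)
  assume "x \<noteq> 0"
  then obtain y where "y \<in> weight_space (- 0)" "B x y = 1"
    using dual_weight_vector[of x 0] x by (auto simp: weight_space_0)
  with 0[of y] show False by (simp add: weight_space_0)
qed

lemma dual_vector_eqI:
  assumes "t \<in> \<hh>" and "\<And>y. y \<in> \<hh> \<Longrightarrow> B t y = \<beta> y"
  shows "dual_vector B \<hh> \<beta> = t"
  unfolding dual_vector_def
proof (rule the_equality)
  fix s assume s: "s \<in> \<hh> \<and> (\<forall>x\<in>\<hh>. B s x = \<beta> x)"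
  have "s - t = 0"
    by (rule form_nondegenerate_cartan)
      (use s assms subspace_cartan in \<open>auto simp: subspace_diff form_diff\<close>)
  then show "s = t" by simp
qed (use assms in auto)

text \<open>
  The element of \<open>\<hh>\<close> that represents a weight through \<open>B\<close>; it is characterized by this property only for
  root weights, for which it exists by \<open>weight_dual\<close> below.
\<close>

definition weight_dual :: "('i \<Rightarrow> int) \<Rightarrow> 'g" where
  "weight_dual n = dual_vector B \<hh> (weight_value n)"

lemma form_bracket_cartan:
  assumes "x \<in> weight_space n" "y \<in> weight_space (- n)" "z \<in> \<hh>"
  shows "bracket x y \<in> \<hh>" "B (bracket x y) z = B x y * weight_value n z"
proof -
  show "bracket x y \<in> \<hh>" using bracket_weight_space[OF assms(1,2)] by (simp add: weight_space_0)
  have "bracket z y = - weight_value n z *s y"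
    using assms by (simp add: bracket_cartan_weight weight_value_simps)
  then have "bracket y z = weight_value n z *s y" using bracket_antisym[of y z] by simp
  then show "B (bracket x y) z = B x y * weight_value n z"
    by (simp add: form_invariant form_simps)
qed

text \<open>
  For root vectors \<open>e\<close>, \<open>f\<close> of opposite roots with \<open>B e f = 1\<close> the bracket \<open>bracket e f\<close> represents
  the root, by invariance of the form.
\<close>

lemma weight_dual:
  assumes "n \<in> root_weights"
  shows "weight_dual n \<in> \<hh>" and "y \<in> \<hh> \<Longrightarrow> B (weight_dual n) y = weight_value n y"
    and "y \<in> \<hh> \<Longrightarrow> B y (weight_dual n) = weight_value n y"
proof -
  obtain e where e: "e \<in> weight_space n" "e \<noteq> 0"
    using assms zero_weight_space[of n] by (auto simp: root_weights_def)
  then obtain f where f: "f \<in> weight_space (- n)" "B e f = 1" using dual_weight_vector by blast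
  have "bracket e f \<in> \<hh>" using form_bracket_cartan(1)[OF e(1) f(1) coweight_cartan] .
  moreover have "B (bracket e f) y = weight_value n y" if "y \<in> \<hh>" for y
    using form_bracket_cartan(2)[OF e(1) f(1) that] f(2) by simp
  ultimately have "weight_dual n \<in> \<hh> \<and> (\<forall>y\<in>\<hh>. B (weight_dual n) y = weight_value n y)"
    unfolding weight_dual_def by (subst (1 2) dual_vector_eqI[of "bracket e f"]) auto
  then show "weight_dual n \<in> \<hh>" and "y \<in> \<hh> \<Longrightarrow> B (weight_dual n) y = weight_value n y"
    and "y \<in> \<hh> \<Longrightarrow> B y (weight_dual n) = weight_value n y"
    using form_sym[of y] by auto
qed

lemma weight_dual_eqI:
  assumes "t \<in> \<hh>" and "\<And>y. y \<in> \<hh> \<Longrightarrow> B t y = weight_value n y"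
  shows "weight_dual n = t"
  unfolding weight_dual_def using assms by (rule dual_vector_eqI)

lemma bracket_opposite_roots:
  assumes n: "n \<in> root_weights" and xy: "x \<in> weight_space n" "y \<in> weight_space (- n)"
  shows "bracket x y = B x y *s weight_dual n"
proof -
  have "bracket x y - B x y *s weight_dual n = 0"
  proof (rule form_nondegenerate_cartan)
    show "bracket x y - B x y *s weight_dual n \<in> \<hh>"
      using form_bracket_cartan(1)[OF xy coweight_cartan] weight_dual(1)[OF n] subspace_cartan
      by (simp add: subspace_diff subspace_scale)
    show "B (bracket x y - B x y *s weight_dual n) z = 0" if "z \<in> \<hh>" for z
      using form_bracket_cartan(2)[OF xy that] weight_dual(2)[OF n that]
      by (simp add: form_diff form_simps)
  qed
  then show ?thesis by simp
qed

text \<open>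
  The scaled vector represents \<open>n\<close> through the Killing form. Its coordinates solve a linear system with real
  coefficients, so their real parts solve it too, and by uniqueness the coordinates are real.
\<close>

lemma scaled_weight_dual:
  assumes n: "n \<in> root_weights"
  shows "form_factor *s weight_dual n \<in> real_cartan"
    and "form_factor *s weight_dual n \<noteq> 0"
    and "dual_vector killing_form \<hh> (weight_value n) = form_factor *s weight_dual n"
proof -
  define u where "u = form_factor *s weight_dual n"
  have u: "u \<in> \<hh>" unfolding u_def using weight_dual(1)[OF n] subspace_cartan by (simp add: subspace_scale)
  have ku: "killing_form u y = weight_value n y" if "y \<in> \<hh>" for y
    using weight_dual(2)[OF n that] by (simp add: u_def killing_form_simps form_eq)
  have unique: "s = u" if s: "s \<in> \<hh>" "\<And>j. killing_form s (W j) = of_int (n j)" for s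
  proof -
    have "s - u = 0"
    proof (rule form_nondegenerate_cartan)
      show "s - u \<in> \<hh>" using s u subspace_cartan by (simp add: subspace_diff)
      fix y assume y: "y \<in> \<hh>"
      have su: "B (s - u) (W j) = 0" for j
        unfolding form_diff using s(2)[of j] ku[of "W j"] by (simp add: form_eq)
      have "B (s - u) (\<Sum>j\<in>A. \<alpha> j y *s W j) = 0" for A
        by (induction A rule: infinite_finite_induct) (simp_all add: form_simps su)
      then show "B (s - u) y = 0" using cartan_expansion[OF y] by metis
    qed
    then show ?thesis by simp
  qed
  define u' where "u' = (\<Sum>j\<in>UNIV. of_real (Re (\<alpha> j u)) *s W j)"
  have sum_real: "(\<Sum>j\<in>A. of_real (r j) *s W j) \<in> real_cartan" if "finite A" for A and r :: "'i \<Rightarrow> real"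
    using that
  proof (induction A rule: finite_induct)
    case empty
    show ?case using real_cartan_simps(2)[OF real_cartan_simps(4), of 0] by simp
  qed (simp_all add: real_cartan_simps)
  have u': "u' \<in> real_cartan" unfolding u'_def by (rule sum_real) simp
  have "u' = u"
  proof (rule unique)
    show "u' \<in> \<hh>" using u' real_cartan_simps by blast
    fix m
    have Re_k: "Re (c * killing_form (W j) (W m)) = Re c * Re (killing_form (W j) (W m))" for c j
      using killing_form_real[OF real_cartan_simps(4) real_cartan_simps(4), of j m]
      by (simp add: complex_is_Real_iff)
    have "real_of_int (n m) = Re (killing_form u (W m))" using ku[of "W m"] by simp
    also have "\<dots> = Re (killing_form u' (W m))"
      by (subst cartan_expansion[OF u])
        (simp only: u'_def killing_form_sum_left killing_form_simps Re_sum Re_k Re_complex_of_real)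
    finally show "killing_form u' (W m) = of_int (n m)"
      using killing_form_real[OF u' real_cartan_simps(4), of m]
      by (simp add: complex_eq_iff complex_is_Real_iff)
  qed
  then show "form_factor *s weight_dual n \<in> real_cartan" using u' by (simp add: u_def)
  show "form_factor *s weight_dual n \<noteq> 0"
  proof
    assume "form_factor *s weight_dual n = 0"
    then have "u = 0" by (simp add: u_def)
    then have "of_int (n j) = (0::complex)" for j
      using ku[of "W j"] by (simp add: killing_form_simps)
    then have "n = 0" by (simp add: fun_eq_iff)
    with n show False by (simp add: root_weights_def)
  qed
  have "dual_vector killing_form \<hh> (weight_value n) = u"
    unfolding dual_vector_def
  proof (rule the_equality)
    show "s = u" if "s \<in> \<hh> \<and> (\<forall>x\<in>\<hh>. killing_form s x = weight_value n x)" for s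
      using that by (intro unique) auto
  qed (use u ku in auto)
  then show "dual_vector killing_form \<hh> (weight_value n) = form_factor *s weight_dual n"
    by (simp add: u_def)
qed

definition sq_length :: "('i \<Rightarrow> int) \<Rightarrow> real" where
  "sq_length n = Re (B (weight_dual n) (weight_dual n))"

definition long_weights :: "('i \<Rightarrow> int) set" where
  "long_weights = {n \<in> root_weights. sq_length n = 2}"

text \<open>
  The factor is fixed by a long root: its squared length 2 times the factor is a positive value of the
  Killing form.
\<close>

lemma form_factor_positive: "form_factor \<in> \<real>" "Re form_factor > 0"
proof -
  obtain n where n: "n \<in> root_weights" "long_root \<hh> (weight_value n)" using exists_long_root by blast
  let ?u = "form_factor *s weight_dual n"
  have "B (weight_dual n) (weight_dual n) = 2"
    using n(2) normalized by (simp add: normalized_killing_form_def dual_form_def weight_dual_def)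
  then have "killing_form ?u ?u = 2 * form_factor"
    by (simp add: form_eq killing_form_simps)
  then show "form_factor \<in> \<real>" "Re form_factor > 0"
    using killing_form_real[of ?u ?u] killing_form_positive[of ?u] scaled_weight_dual[OF n(1)]
    by (auto simp: complex_is_Real_iff)
qed

lemma weight_dual_real: "n \<in> root_weights \<Longrightarrow> weight_dual n \<in> real_cartan"
  using real_cartan_simps(2)[OF scaled_weight_dual(1), of n "inverse form_factor"]
    form_factor_positive(1) form_factor_nonzero by simp

lemma form_real: "x \<in> real_cartan \<Longrightarrow> y \<in> real_cartan \<Longrightarrow> B x y \<in> \<real>"
  using killing_form_real[of x y] form_factor_positive by (auto simp: form_eq)

lemma form_positive: "x \<in> real_cartan \<Longrightarrow> x \<noteq> 0 \<Longrightarrow> Re (B x x) > 0"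
  using killing_form_positive[of x] form_factor_positive
  by (simp add: form_eq complex_is_Real_iff)

lemma dual_form_eq:
  assumes "n \<in> root_weights"
  shows "dual_form B \<hh> (weight_value n) (weight_value n) = of_real (sq_length n)"
  using form_real[OF weight_dual_real[OF assms] weight_dual_real[OF assms]]
  by (simp add: dual_form_def sq_length_def weight_dual_def complex_is_Real_iff complex_eq_iff)

lemma killing_dual_form:
  assumes n: "n \<in> root_weights"
  shows "Re (dual_form killing_form \<hh> (weight_value n) (weight_value n)) = Re form_factor * sq_length n"
proof -
  have "dual_form killing_form \<hh> (weight_value n) (weight_value n) =
      form_factor * B (weight_dual n) (weight_dual n)"
    by (simp add: dual_form_def scaled_weight_dual[OF n] killing_form_simps form_eq)
  then show ?thesis using form_factor_positive(1) by (simp add: sq_length_def complex_is_Real_iff)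
qed

lemma sq_length_positive:
  assumes "n \<in> root_weights"
  shows "sq_length n > 0"
  unfolding sq_length_def
  using scaled_weight_dual(2)[OF assms] by (intro form_positive weight_dual_real assms) auto

lemma sq_length_le_2: "n \<in> root_weights \<Longrightarrow> sq_length n \<le> 2"
  and exists_long_weight: "\<exists>n. n \<in> long_weights"
proof -
  obtain m where m: "m \<in> root_weights" "long_root \<hh> (weight_value m)" using exists_long_root by blast
  have "dual_form B \<hh> (weight_value m) (weight_value m) = 2"
    using m(2) normalized by (simp add: normalized_killing_form_def)
  then have "complex_of_real (sq_length m) = of_real 2" using m(1) by (simp add: dual_form_eq)
  then have sq: "sq_length m = 2" by (simp only: of_real_eq_iff)
  then show "\<exists>n. n \<in> long_weights" using m(1) by (auto simp: long_weights_def)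
  assume n: "n \<in> root_weights"
  then have "Re form_factor * sq_length n \<le> Re form_factor * sq_length m"
    using m by (auto simp: long_root_def roots_eq killing_dual_form)
  then show "sq_length n \<le> 2" using form_factor_positive(2) sq by simp
qed

lemma weight_value_weight_dual:
  "n \<in> root_weights \<Longrightarrow> m \<in> root_weights \<Longrightarrow> weight_value n (weight_dual m) = B (weight_dual n) (weight_dual m)"
  using weight_dual(2)[of n "weight_dual m"] weight_dual(1)[of m] by simp

lemma form_weight_dual_self: "n \<in> root_weights \<Longrightarrow> B (weight_dual n) (weight_dual n) = of_real (sq_length n)"
  using dual_form_eq by (simp add: dual_form_def weight_dual_def)

definition coroot :: "('i \<Rightarrow> int) \<Rightarrow> 'g" where
  "coroot n = of_real (2 / sq_length n) *s weight_dual n"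

lemma coroot_in_cartan: "n \<in> root_weights \<Longrightarrow> coroot n \<in> \<hh>"
  using weight_dual(1) subspace_cartan by (simp add: coroot_def subspace_scale)

lemma weight_value_coroot:
  "n \<in> root_weights \<Longrightarrow> m \<in> root_weights \<Longrightarrow>
    weight_value m (coroot n) = of_real (2 / sq_length n) * B (weight_dual m) (weight_dual n)"
  by (simp add: coroot_def weight_value_linear weight_dual(1) weight_value_weight_dual)

lemma weight_value_coroot_self: "n \<in> root_weights \<Longrightarrow> weight_value n (coroot n) = 2"
  using sq_length_positive[of n] by (simp add: weight_value_coroot form_weight_dual_self)

lemma exists_sl2_triple:
  assumes n: "n \<in> root_weights"
  shows "\<exists>e f. e \<in> weight_space n \<and> f \<in> weight_space (- n) \<and>
    B e f = of_real (2 / sq_length n) \<and> bracket e f = coroot n"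
proof -
  obtain e where e: "e \<in> weight_space n" "e \<noteq> 0"
    using assms zero_weight_space[of n] by (auto simp: root_weights_def)
  then obtain f where f: "f \<in> weight_space (- n)" "B e f = 1" using dual_weight_vector by blast
  let ?f = "of_real (2 / sq_length n) *s f"
  have f': "?f \<in> weight_space (- n)" using f subspace_weight_space by (simp add: subspace_scale)
  moreover have "B e ?f = of_real (2 / sq_length n)" using f by (simp add: form_simps)
  ultimately show ?thesis
    using e bracket_opposite_roots[OF n e(1) f'] by (auto simp: coroot_def)
qed

lemma sl2_coroot:
  assumes n: "n \<in> root_weights" and "e \<in> weight_space n" "f \<in> weight_space (- n)" "bracket e f = coroot n"
  shows "sl2_module scale (bracket e) (bracket f) (bracket (coroot n))"
  by (rule sl2_adjoint[OF assms(2,3) _ assms(4) weight_value_coroot_self[OF n]])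
    (use n in \<open>simp add: root_weights_def\<close>)

lemma neg_root_weight:
  assumes "n \<in> root_weights"
  shows "- n \<in> root_weights" "weight_dual (- n) = - weight_dual n" "sq_length (- n) = sq_length n"
    "coroot (- n) = - coroot n"
proof -
  obtain e f where ef: "e \<in> weight_space n" "f \<in> weight_space (- n)"
    "B e f = of_real (2 / sq_length n)"
    using exists_sl2_triple[OF assms] by blast
  then have "f \<noteq> 0" using sq_length_positive[OF assms] by (auto simp: form_simps)
  then show "- n \<in> root_weights" using ef assms by (auto simp: root_weights_def)
  show d: "weight_dual (- n) = - weight_dual n"
    by (rule weight_dual_eqI)
      (use assms subspace_cartan in \<open>auto simp: weight_dual subspace_neg form_minus weight_value_simps\<close>)
  then show l: "sq_length (- n) = sq_length n" by (simp add: sq_length_def form_minus)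
  show "coroot (- n) = - coroot n" unfolding coroot_def l d by simp
qed

text \<open>
  \<open>coroot n\<close> is the semisimple element of a triple that acts locally nilpotently in the adjoint
  representation.
\<close>

lemma coroot_integral:
  assumes n: "n \<in> root_weights" and x: "x \<in> weight_space m" "x \<noteq> 0"
  shows "\<exists>z. weight_value m (coroot n) = of_int z"
proof -
  obtain e f where "e \<in> weight_space n" "f \<in> weight_space (- n)" "bracket e f = coroot n"
    using exists_sl2_triple[OF n] by blast
  then interpret sl2_module scale "bracket e" "bracket f" "bracket (coroot n)"
    by (rule sl2_coroot[OF n])
  show ?thesis
    by (rule weight_int[OF _ x(2)]) (rule bracket_cartan_weight[OF coroot_in_cartan[OF n] x(1)])
qed

lemma root_weight_vector: "n \<in> root_weights \<Longrightarrow> \<exists>x\<in>weight_space n. x \<noteq> 0"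
  using zero_weight_space[of n] by (auto simp: root_weights_def)

lemma bracket_pow_weight_space:
  "e \<in> weight_space n \<Longrightarrow> x \<in> weight_space m \<Longrightarrow> (bracket e ^^ k) x \<in> weight_space (\<lambda>j. m j + int k * n j)"
proof (induction k)
  case (Suc k)
  then have "bracket e ((bracket e ^^ k) x) \<in> weight_space (n + (\<lambda>j. m j + int k * n j))"
    using bracket_weight_space by blast
  also have "n + (\<lambda>j. m j + int k * n j) = (\<lambda>j. m j + int (Suc k) * n j)"
    by (auto simp: fun_eq_iff algebra_simps)
  finally show ?case by simp
qed simp

text \<open>
  A power of \<open>f\<close> or \<open>e\<close>, according to the sign of \<open>z\<close>, maps the root space of \<open>m\<close> injectively to the one
  of the reflected root.
\<close>

lemma reflection:
  assumes n: "n \<in> root_weights" and m: "m \<in> root_weights" and z: "weight_value m (coroot n) = of_int z"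
  shows "(\<lambda>j. m j - z * n j) \<in> root_weights" (is "?m \<in> _")
    and "weight_dual (\<lambda>j. m j - z * n j) = weight_dual m - of_int z *s weight_dual n"
    and "sq_length (\<lambda>j. m j - z * n j) = sq_length m"
proof -
  obtain e f where e: "e \<in> weight_space n" and f: "f \<in> weight_space (- n)" and ef: "bracket e f = coroot n"
    using exists_sl2_triple[OF n] by blast
  interpret sl2_module scale "bracket e" "bracket f" "bracket (coroot n)"
    by (rule sl2_coroot[OF n e f ef])
  interpret op: sl2_module scale "bracket f" "bracket e" "\<lambda>v. - bracket (coroot n) v" by (rule opposite)
  obtain x where x: "x \<in> weight_space m" "x \<noteq> 0" using root_weight_vector[OF m] by blast
  have hx: "bracket (coroot n) x = of_int z *s x"
    using bracket_cartan_weight[OF coroot_in_cartan[OF n] x(1)] z by simp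
  have wv: "weight_value ?m y = weight_value m y - of_int z * weight_value n y" for y
    by (simp add: weight_value_def sum_subtractf sum_distrib_left algebra_simps)
  have "weight_space ?m \<noteq> {0}"
  proof (cases "z \<ge> 0")
    case True
    then have "bracket (coroot n) x = of_nat (nat z) *s x" using hx by simp
    then have "(bracket f ^^ nat z) x \<noteq> 0" using f_pow_injective_on_weight_space x by blast
    moreover have "(bracket f ^^ nat z) x \<in> weight_space ?m"
      using bracket_pow_weight_space[OF f x(1), of "nat z"] True by simp
    ultimately show ?thesis by blast
  next
    case False
    then have "- bracket (coroot n) x = of_nat (nat (- z)) *s x" using hx by simp
    then have "(bracket e ^^ nat (- z)) x \<noteq> 0" using op.f_pow_injective_on_weight_space x by blast
    moreover have "(bracket e ^^ nat (- z)) x \<in> weight_space ?m"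
      using bracket_pow_weight_space[OF e x(1), of "nat (- z)"] False by simp
    ultimately show ?thesis by blast
  qed
  moreover have "?m \<noteq> 0"
  proof
    assume "?m = 0"
    then have "weight_value ?m y = 0" for y by (simp only: weight_value_simps)
    then have 0: "weight_value m y = of_int z * weight_value n y" for y using wv by simp
    have "of_int z = of_int z * (2::complex)"
      using 0[of "coroot n"] z weight_value_coroot_self[OF n] by simp
    then have "z = 0" by simp
    with 0 have "weight_value m (W j) = 0" for j by (simp only: of_int_0 mult_zero_left)
    then have "m = 0" by (simp add: fun_eq_iff)
    with m show False by (simp add: root_weights_def)
  qed
  ultimately show "?m \<in> root_weights" by (simp add: root_weights_def)
  show d: "weight_dual ?m = weight_dual m - of_int z *s weight_dual n"
    by (rule weight_dual_eqI)
      (use n m subspace_cartan in \<open>auto simp: weight_dual subspace_diff subspace_scale form_diff form_simps wv\<close>)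
  have "2 * B (weight_dual m) (weight_dual n) = of_int z * of_real (sq_length n)"
    using z sq_length_positive[OF n] by (simp add: weight_value_coroot n m field_simps)
  then have "B (weight_dual ?m) (weight_dual ?m) = B (weight_dual m) (weight_dual m)"
    using form_sym[of "weight_dual n" "weight_dual m"]
    by (simp add: d form_diff form_simps form_weight_dual_self n m algebra_simps)
  then show "sq_length ?m = sq_length m" by (simp add: sq_length_def)
qed

lemma coroot_long: "n \<in> long_weights \<Longrightarrow> coroot n = weight_dual n"
  by (simp add: coroot_def long_weights_def)

text \<open>
  This is the Cauchy-Schwarz inequality with its equality case, in the form that
  \<open>weight_dual m - weight_dual n\<close> has nonnegative squared length while no root is longer than \<open>n\<close>.
\<close>

lemma long_coroot_bound:
  assumes n: "n \<in> long_weights" and m: "m \<in> root_weights" and z: "weight_value m (coroot n) = of_int z"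
  shows "z \<le> 2" "z = 2 \<Longrightarrow> m = n" "z \<ge> - 2" "z = - 2 \<Longrightarrow> m = - n"
proof -
  have bound: "z \<le> 2 \<and> (z = 2 \<longrightarrow> m = n)"
    if n: "n \<in> long_weights" and m: "m \<in> root_weights" and z: "weight_value m (coroot n) = of_int z"
    for n m z
  proof -
    have n': "n \<in> root_weights" "sq_length n = 2" using n by (auto simp: long_weights_def)
    let ?x = "weight_dual m + - 1 *s weight_dual n"
    have zB: "B (weight_dual m) (weight_dual n) = of_int z" "B (weight_dual n) (weight_dual m) = of_int z"
      using z coroot_long[OF n] m n'(1) form_sym by (simp_all add: weight_value_weight_dual)
    have x: "?x \<in> real_cartan" using weight_dual_real m n' by (simp add: real_cartan_simps del: scale_minus_left)
    have "B ?x ?x = of_real (sq_length m + 2 - 2 * of_int z)"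
      using n' by (simp add: form_simps form_minus form_diff form_weight_dual_self m zB)
    then have Bx: "Re (B ?x ?x) = sq_length m + 2 - 2 * of_int z" by simp
    have "Re (B ?x ?x) \<ge> 0" using form_positive[OF x] by (cases "?x = 0") (auto simp: form_simps)
    then have "z \<le> 2" using Bx sq_length_le_2[OF m] by linarith
    moreover have "m = n" if "z = 2"
    proof -
      have "\<not> Re (B ?x ?x) > 0" using Bx that sq_length_le_2[OF m] by simp
      then have "?x = 0" using form_positive[OF x] by blast
      then have "weight_dual m = weight_dual n" by simp
      then have "weight_value m (W j) = weight_value n (W j)" for j
        using weight_dual(2)[OF m, of "W j"] weight_dual(2)[OF n'(1), of "W j"] by simp
      then show ?thesis by (simp add: fun_eq_iff)
    qed
    ultimately show ?thesis by blast
  qed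
  show "z \<le> 2" "z = 2 \<Longrightarrow> m = n" using bound[OF n m z] by auto
  have "- z \<le> 2 \<and> (- z = 2 \<longrightarrow> - m = n)"
    using n m z by (intro bound) (auto simp: neg_root_weight weight_value_simps)
  then show "z \<ge> - 2" "z = - 2 \<Longrightarrow> m = - n" by auto
qed

text \<open>
  The weight \<open>m + 2 n\<close> takes a value larger than 2 on \<open>coroot n\<close>.
\<close>

lemma long_ad_twice_zero:
  assumes n: "n \<in> long_weights" and e: "e \<in> weight_space n" and x: "x \<in> weight_space m" and m: "m \<noteq> - n"
  shows "bracket e (bracket e x) = 0"
proof (rule ccontr)
  assume nz: "bracket e (bracket e x) \<noteq> 0"
  have n': "n \<in> root_weights" "n \<noteq> 0" using n by (auto simp: long_weights_def root_weights_def)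
  have in2: "bracket e (bracket e x) \<in> weight_space (n + (n + m))"
    using e x by (intro bracket_weight_space)
  have "x \<noteq> 0" using nz by (auto simp: bracket_simps)
  then obtain z where z: "weight_value m (coroot n) = of_int z"
    using coroot_integral[OF n'(1) x] by blast
  have m2: "weight_value (n + (n + m)) (coroot n) = of_int (z + 4)"
    by (simp only: weight_value_simps weight_value_coroot_self[OF n'(1)] z) simp
  have "z + 4 \<le> 2"
  proof (cases "n + (n + m) = 0")
    case True
    then have "of_int (z + 4) = (of_int 0 :: complex)" using m2 by (simp add: weight_value_simps)
    then show ?thesis by (simp only: of_int_eq_iff)
  next
    case False
    then have "n + (n + m) \<in> root_weights" using in2 nz by (auto simp: root_weights_def)
    from long_coroot_bound(1)[OF n this m2] show ?thesis .
  qed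
  moreover have "m \<in> root_weights"
  proof -
    have "m \<noteq> 0" using z calculation by (auto simp: weight_value_simps)
    then show ?thesis using x \<open>x \<noteq> 0\<close> by (auto simp: root_weights_def)
  qed
  ultimately show False using long_coroot_bound(3,4)[OF n _ z] m by force
qed

text \<open>
  The roots split into the set \<open>Orth\<close> of those orthogonal to all long roots and its complement \<open>N\<close>. The two
  sets are orthogonal to each other: if \<open>d\<close> in \<open>N\<close> is not orthogonal to the long root \<open>n\<close>, then reflecting \<open>n\<close>
  in \<open>d\<close> gives another long root, and elements of \<open>Orth\<close> are orthogonal to both, hence to \<open>d\<close>. Hence no sum of a root in
  \<open>Orth\<close> and a root in \<open>N\<close> is a root, and the centralizer \<open>K\<close> of the root spaces in \<open>N\<close> is an ideal. It does not
  contain the long root spaces, so it is zero and \<open>Orth\<close> is empty.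
\<close>

lemma exists_nonorthogonal_long_root:
  assumes m: "m \<in> root_weights"
  shows "\<exists>n\<in>long_weights. B (weight_dual n) (weight_dual m) \<noteq> 0"
proof (rule ccontr)
  define Orth where "Orth = {m \<in> root_weights. \<forall>n\<in>long_weights. B (weight_dual n) (weight_dual m) = 0}"
  define N where "N = root_weights - Orth"
  assume "\<not> (\<exists>n\<in>long_weights. B (weight_dual n) (weight_dual m) \<noteq> 0)"
  then have mO: "m \<in> Orth" using m by (simp add: Orth_def)
  have Orth_neg: "- b \<in> Orth" if "b \<in> Orth" for b
    using that by (simp add: Orth_def neg_root_weight form_minus)
  have N_neg: "- b \<in> N" if "b \<in> N" for b
    using that Orth_neg[of "- b"] by (auto simp: N_def neg_root_weight)
  have orth: "B (weight_dual d) (weight_dual b) = 0" if b: "b \<in> Orth" and d: "d \<in> N" for b d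
  proof -
    have dr: "d \<in> root_weights" using d by (simp add: N_def)
    obtain n where n: "n \<in> long_weights" and nd: "B (weight_dual n) (weight_dual d) \<noteq> 0"
      using d by (auto simp: N_def Orth_def)
    have nr: "n \<in> root_weights" "sq_length n = 2" using n by (auto simp: long_weights_def)
    obtain x where "x \<in> weight_space n" "x \<noteq> 0" using root_weight_vector[OF nr(1)] by blast
    then obtain z where z: "weight_value n (coroot d) = of_int z" using coroot_integral[OF dr] by blast
    have "z \<noteq> 0" using z nd sq_length_positive[OF dr] by (auto simp: weight_value_coroot dr nr)
    have "(\<lambda>j. n j - z * d j) \<in> long_weights"
      using reflection[OF dr nr(1) z] nr by (simp add: long_weights_def)
    then have "B (weight_dual n - of_int z *s weight_dual d) (weight_dual b) = 0"
      using b reflection(2)[OF dr nr(1) z] by (auto simp: Orth_def)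
    moreover have "B (weight_dual n) (weight_dual b) = 0" using b n by (simp add: Orth_def)
    ultimately show ?thesis using \<open>z \<noteq> 0\<close> by (simp add: form_diff form_simps)
  qed
  have ON: "bracket x y = 0" if b: "b \<in> Orth" and d: "d \<in> N" and x: "x \<in> weight_space b" and y: "y \<in> weight_space d"
    for b d x y
  proof (rule ccontr)
    assume nz: "bracket x y \<noteq> 0"
    have br: "b \<in> root_weights" and dr: "d \<in> root_weights" using b d by (auto simp: Orth_def N_def)
    have "b + d \<noteq> 0"
    proof
      assume "b + d = 0"
      then have "d = - b" by (simp add: add_eq_0_iff)
      then show False using Orth_neg[OF b] d by (simp add: N_def)
    qed
    then have bd: "b + d \<in> root_weights"
      using nz bracket_weight_space[OF x y] by (auto simp: root_weights_def)
    have dual: "weight_dual (b + d) = weight_dual b + weight_dual d"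
      by (rule weight_dual_eqI)
        (use br dr subspace_cartan in \<open>auto simp: weight_dual subspace_add form_simps weight_value_simps\<close>)
    have pos: "B (weight_dual r) (weight_dual r) \<noteq> 0" if "r \<in> root_weights" for r
      using sq_length_positive[OF that] by (simp add: form_weight_dual_self that)
    show False
    proof (cases "b + d \<in> Orth")
      case True
      from orth[OF this d] orth[OF b d] pos[OF dr] show False by (simp add: dual form_simps)
    next
      case False
      then have "b + d \<in> N" using bd by (simp add: N_def)
      from orth[OF b this] orth[OF b d] pos[OF br] show False by (simp add: dual form_simps)
    qed
  qed
  define K where "K = {x. \<forall>d\<in>N. \<forall>y\<in>weight_space d. bracket x y = 0}"
  have K_subspace: "subspace K" by (auto simp: subspace_def K_def bracket_simps)
  have K_bracket: "bracket x y \<in> K" if "x \<in> K" "y \<in> K" for x y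
  proof -
    have "bracket (bracket x y) z = 0" if "d \<in> N" "z \<in> weight_space d" for d z
      using bracket_derivation[of x y z] that \<open>x \<in> K\<close> \<open>y \<in> K\<close> by (auto simp: K_def bracket_simps)
    then show ?thesis by (simp add: K_def)
  qed
  have stab: "bracket u x \<in> K" if r: "r \<in> root_weights" and u: "u \<in> weight_space r" and x: "x \<in> K" for r u x
  proof (cases "r \<in> Orth")
    case True
    then have "u \<in> K" using ON u by (auto simp: K_def)
    then show ?thesis using K_bracket x by blast
  next
    case False
    then have "bracket x u = 0" using x r u by (auto simp: K_def N_def)
    then have "bracket u x = 0" using bracket_antisym[of u x] by simp
    then show ?thesis using subspace_0[OF K_subspace] by simp
  qed
  have "{u. \<forall>x\<in>K. bracket u x \<in> K} = UNIV"
  proof (rule subalgebra_eq_UNIV)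
    show "subspace {u. \<forall>x\<in>K. bracket u x \<in> K}"
      using K_subspace by (auto simp: subspace_def bracket_simps)
    show "bracket u v \<in> {u. \<forall>x\<in>K. bracket u x \<in> K}"
      if "u \<in> {u. \<forall>x\<in>K. bracket u x \<in> K}" "v \<in> {u. \<forall>x\<in>K. bracket u x \<in> K}" for u v
    proof (intro CollectI ballI)
      fix x assume "x \<in> K"
      then have "bracket u (bracket v x) - bracket v (bracket u x) \<in> K"
        using that by (intro subspace_diff[OF K_subspace]) auto
      then show "bracket (bracket u v) x \<in> K" using bracket_derivation[of u v x] by simp
    qed
    show "E i \<in> {u. \<forall>x\<in>K. bracket u x \<in> K}" "F i \<in> {u. \<forall>x\<in>K. bracket u x \<in> K}" for i
      using stab[OF simple_weight_root generators_weight_space(1)]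
        stab[OF neg_root_weight(1)[OF simple_weight_root] generators_weight_space(2)] by blast+
  qed
  then have "lie_ideal K" using K_subspace unfolding lie_ideal_def by blast
  then consider "K = {0}" | "K = UNIV" using ideal_trivial by blast
  then show False
  proof cases
    case 1
    obtain x where "x \<in> weight_space m" "x \<noteq> 0" using root_weight_vector[OF m] by blast
    moreover then have "x \<in> K" using ON mO by (auto simp: K_def)
    ultimately show False using 1 by blast
  next
    case 2
    obtain n where n: "n \<in> long_weights" using exists_long_weight by blast
    then have nr: "n \<in> root_weights" "sq_length n = 2" by (auto simp: long_weights_def)
    then have "B (weight_dual n) (weight_dual n) \<noteq> 0" by (simp add: form_weight_dual_self)
    then have "n \<in> N" using n nr by (auto simp: N_def Orth_def)
    obtain x where x: "x \<in> weight_space n" "x \<noteq> 0" using root_weight_vector[OF nr(1)] by blast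
    have "bracket x y = 0" for y
    proof -
      have "y \<in> K" by (simp add: 2)
      then have "bracket y x = 0" using x \<open>n \<in> N\<close> by (auto simp: K_def)
      then show ?thesis using bracket_antisym[of x y] by simp
    qed
    then have "x = 0" by (rule center_trivial)
    with x show False by simp
  qed
qed

text \<open>
  A long root \<open>n\<close> that is not orthogonal to \<open>m\<close> has \<open>weight_value m (coroot n) = 1\<close> or \<open>-1\<close> by the
  bounds above; in the second case \<open>- n\<close> serves.
\<close>

lemma long_or_adjacent_to_long:
  assumes m: "m \<in> root_weights" and short: "m \<notin> long_weights"
  shows "\<exists>n\<in>long_weights. weight_value m (coroot n) = 1"
proof -
  obtain n where n: "n \<in> long_weights" and B: "B (weight_dual n) (weight_dual m) \<noteq> 0"
    using exists_nonorthogonal_long_root[OF m] by blast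
  have nr: "n \<in> root_weights" "sq_length n = 2" using n by (auto simp: long_weights_def)
  obtain x where "x \<in> weight_space m" "x \<noteq> 0" using root_weight_vector[OF m] by blast
  then obtain z where z: "weight_value m (coroot n) = of_int z" using coroot_integral[OF nr(1)] by blast
  have "z \<noteq> 0" using z B nr m form_sym by (auto simp: weight_value_coroot)
  moreover have "- n \<in> long_weights" using nr by (simp add: long_weights_def neg_root_weight)
  moreover have "z \<noteq> 2" "z \<noteq> - 2" using long_coroot_bound(2,4)[OF n m z] short n calculation(2) by auto
  moreover note long_coroot_bound(1,3)[OF n m z]
  ultimately have "z = 1 \<or> z = - 1" by linarith
  then show ?thesis
  proof
    assume "z = 1"
    with z n show ?thesis by auto
  next
    assume "z = - 1"
    then have "weight_value m (coroot (- n)) = 1"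
      using z nr coroot_in_cartan[OF nr(1)] weight_value_linear(2)[of "coroot n" m "- 1"]
      by (simp add: neg_root_weight)
    with \<open>- n \<in> long_weights\<close> show ?thesis by blast
  qed
qed

text \<open>
  For a short root \<open>m\<close> with adjacent long root \<open>n\<close>, the number \<open>2 / sq_length m\<close> is the value of \<open>n\<close> at
  the coroot of \<open>m\<close>.
\<close>

lemma inverse_length_integral:
  assumes m: "m \<in> root_weights"
  shows "\<exists>z. of_real (2 / sq_length m) = (of_int z :: complex)"
proof (cases "m \<in> long_weights")
  case True
  then show ?thesis by (intro exI[of _ 1]) (simp add: long_weights_def)
next
  case False
  then obtain n where n: "n \<in> long_weights" "weight_value m (coroot n) = 1"
    using long_or_adjacent_to_long[OF m] by blast
  then have nr: "n \<in> root_weights" by (simp add: long_weights_def)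
  have 1: "B (weight_dual n) (weight_dual m) = 1"
    using n nr m form_sym by (simp add: coroot_long weight_value_weight_dual)
  obtain x where "x \<in> weight_space n" "x \<noteq> 0" using root_weight_vector[OF nr] by blast
  then obtain z where z: "weight_value n (coroot m) = of_int z" using coroot_integral[OF m] by blast
  then show ?thesis using 1 nr m by (auto simp: weight_value_coroot)
qed

lemma chevalley_coroot:
  "H i = coroot (simple_weight i)" "B (E i) (F i) = of_real (2 / sq_length (simple_weight i))"
proof -
  let ?n = "simple_weight i"
  have H: "H i = B (E i) (F i) *s weight_dual ?n"
    using bracket_opposite_roots[OF simple_weight_root generators_weight_space]
    by (simp add: generator_brackets)
  have "2 = weight_value ?n (H i)" by (simp add: generator_brackets)
  also have "\<dots> = B (E i) (F i) * of_real (sq_length ?n)"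
    unfolding H using weight_dual(1)[OF simple_weight_root]
    by (simp only: weight_value_linear weight_value_weight_dual[OF simple_weight_root simple_weight_root]
        form_weight_dual_self[OF simple_weight_root])
  finally show B: "B (E i) (F i) = of_real (2 / sq_length ?n)"
    using sq_length_positive[OF simple_weight_root, of i] by (simp add: field_simps)
  from B show "H i = coroot ?n" unfolding H coroot_def by simp
qed

end

section \<open>Vacuum modules\<close>

text \<open>
  The conditions that characterize \<open>L(k,0)\<close> with its degree operator, expressed through the modes
  \<open>md x n\<close> of \<open>x \<otimes> t\<^sup>n\<close> alone.
\<close>

locale vacuum_module = normalized_cartan_data scale bracket \<hh> \<alpha> E F H W B + M: vector_space scaleM
  for scale :: "complex \<Rightarrow> 'g::ab_group_add \<Rightarrow> 'g" (infixr \<open>*s\<close> 75)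
    and bracket :: "'g \<Rightarrow> 'g \<Rightarrow> 'g"
    and \<hh> :: "'g set" and \<alpha> :: "'i::finite \<Rightarrow> 'g \<Rightarrow> complex" and E F H W :: "'i \<Rightarrow> 'g"
    and B :: "'g \<Rightarrow> 'g \<Rightarrow> complex"
    and scaleM :: "complex \<Rightarrow> 'v::ab_group_add \<Rightarrow> 'v" (infixr \<open>*v\<close> 75) +
  fixes md :: "'g \<Rightarrow> int \<Rightarrow> 'v \<Rightarrow> 'v" and k :: nat and vac :: 'v and D :: "'v \<Rightarrow> 'v"
  assumes mode_add: "md (x + y) n v = md x n v + md y n v"
    and mode_scale: "md (c *s x) n v = c *v md x n v"
    and mode_linear: "Vector_Spaces.linear scaleM scaleM (md x n)"
    and mode_commute: "md x m (md y n v) = md y n (md x m v) + md (bracket x y) (m + n) v +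
          (if m + n = 0 then (of_int m * B x y * of_nat k) *v v else 0)"
    and vac_annihilated: "n \<ge> 0 \<Longrightarrow> md x n vac = 0"
    and irreducible: "M.subspace S \<Longrightarrow> (\<And>x n v. v \<in> S \<Longrightarrow> md x n v \<in> S) \<Longrightarrow> S = {0} \<or> S = UNIV"
    and generated: "M.subspace S \<Longrightarrow> (\<And>x n v. v \<in> S \<Longrightarrow> md x n v \<in> S) \<Longrightarrow> vac \<in> S \<Longrightarrow> S = UNIV"
    and nontrivial: "\<exists>v::'v. v \<noteq> 0"
    and degree_linear: "Vector_Spaces.linear scaleM scaleM D"
    and degree_vac: "D vac = 0"
    and degree_mode: "D (md x n v) = md x n (D v) - of_int n *v md x n v"
begin

sublocale md: Vector_Spaces.linear scaleM scaleM "md x n" for x n by (rule mode_linear)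
sublocale D: Vector_Spaces.linear scaleM scaleM D by (rule degree_linear)

lemma mode_zero: "md 0 n v = 0"
  using mode_scale[of 0 0 n v] by simp

lemma mode_minus: "md (- x) n v = - md x n v"
  using mode_scale[of "- 1" x n v] by simp

lemma mode_sum: "md (\<Sum>i\<in>A. f i) n v = (\<Sum>i\<in>A. md (f i) n v)"
  by (induction A rule: infinite_finite_induct) (simp_all add: mode_add mode_zero)

lemma vac_nonzero: "vac \<noteq> 0"
proof
  assume "vac = 0"
  then have "{0} = (UNIV :: 'v set)" by (intro generated) (auto simp: md.zero)
  then show False using nontrivial by auto
qed

lemma mode_pow_zero: "(md x n ^^ q) 0 = 0"
  by (induction q) (simp_all add: md.zero)

lemmas mode_pow_mono = M.iterate_eq_0_mono[OF mode_linear]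

lemma mode_pow_linear: "Vector_Spaces.linear scaleM scaleM (md x n ^^ q)"
  by (rule M.linear_iterate) (rule mode_linear)

text \<open>
  A noncommutative Leibniz rule. The central term costs no extra power: it occurs only for \<open>p > 0\<close>, and
  then the remaining power of the mode still kills \<open>v\<close>.
\<close>

lemma mode_pow_bracket:
  "(bracket e ^^ p) y = 0 \<Longrightarrow> (md e n ^^ q) v = 0 \<Longrightarrow> (md e n ^^ (p + q)) (md y m v) = 0"
proof (induction "p + q" arbitrary: p q y m v)
  case 0
  then show ?case by (simp add: mode_zero)
next
  case (Suc s)
  interpret pw: Vector_Spaces.linear scaleM scaleM "md e n ^^ s" by (rule mode_pow_linear)
  show ?case
  proof (cases "p = 0 \<or> q = 0")
    case True
    then have "y = 0 \<or> v = 0" using Suc.prems by auto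
    then show ?thesis by (auto simp: mode_zero md.zero mode_pow_zero)
  next
    case False
    then obtain p' q' where pq: "p = Suc p'" "q = Suc q'" by (metis not0_implies_Suc)
    have 1: "(md e n ^^ s) (md y m (md e n v)) = 0"
      using Suc.hyps(1)[of p q' y "md e n v" m] Suc.prems Suc.hyps(2) pq by (simp add: funpow_swap1)
    have 2: "(md e n ^^ s) (md (bracket e y) (n + m) v) = 0"
      using Suc.hyps(1)[of p' q "bracket e y" v "n + m"] Suc.prems Suc.hyps(2) pq by (simp add: funpow_swap1)
    have "(md e n ^^ s) v = 0"
      using mode_pow_mono[OF Suc.prems(2), of s] Suc.hyps(2) pq by simp
    then have 3: "(md e n ^^ s) (c *v v) = 0" for c by (simp only: pw.scale M.scale_zero_right)
    have "(md e n ^^ (p + q)) (md y m v) = (md e n ^^ s) (md e n (md y m v))"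
      using Suc.hyps(2) by (metis comp_apply funpow_Suc_right)
    also have "\<dots> = 0"
      unfolding mode_commute[of e n y m] using 1 2 3 by (simp add: pw.add pw.zero)
    finally show ?thesis .
  qed
qed

lemma mode_nilpotent:
  assumes ad: "\<And>y. \<exists>p. (bracket e ^^ p) y = 0" and vac: "(md e n ^^ q) vac = 0"
  shows "\<exists>q. (md e n ^^ q) v = 0"
proof -
  have "{v. \<exists>q. (md e n ^^ q) v = 0} = UNIV"
  proof (rule generated)
    interpret pw: Vector_Spaces.linear scaleM scaleM "md e n ^^ s" for s by (rule mode_pow_linear)
    show "M.subspace {v. \<exists>q. (md e n ^^ q) v = 0}"
      unfolding M.subspace_def
    proof (intro conjI ballI allI)
      fix u v assume "u \<in> {v. \<exists>q. (md e n ^^ q) v = 0}" "v \<in> {v. \<exists>q. (md e n ^^ q) v = 0}"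
      then obtain q q' where "(md e n ^^ q) u = 0" "(md e n ^^ q') v = 0" by blast
      then have "(md e n ^^ max q q') u = 0" "(md e n ^^ max q q') v = 0"
        by (auto intro: mode_pow_mono)
      then have "(md e n ^^ max q q') (u + v) = 0" by (simp add: pw.add)
      then show "u + v \<in> {v. \<exists>q. (md e n ^^ q) v = 0}" by blast
    qed (auto simp: pw.scale pw.zero)
    show "md x m v \<in> {v. \<exists>q. (md e n ^^ q) v = 0}" if "v \<in> {v. \<exists>q. (md e n ^^ q) v = 0}" for x m v
      using that ad[of x] mode_pow_bracket by blast
    show "vac \<in> {v. \<exists>q. (md e n ^^ q) v = 0}" using vac by blast
  qed
  then show ?thesis by blast
qed

lemma nonneg_mode_nilpotent:
  assumes "e \<in> weight_space w" "w \<noteq> 0" and "n \<ge> 0"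
  shows "\<exists>q. (md e n ^^ q) v = 0"
  by (rule mode_nilpotent[where q = 1]) (use root_vector_ad_nilpotent assms vac_annihilated in auto)

definition grade :: "int \<Rightarrow> 'v set" where
  "grade s = {v. D v = of_int s *v v}"

lemma subspace_grade: "M.subspace (grade s)"
  by (auto simp: M.subspace_def grade_def D.add D.scale D.zero M.scale_right_distrib mult.commute)

lemma mode_grade: "v \<in> grade s \<Longrightarrow> md x n v \<in> grade (s - n)"
  by (simp add: grade_def degree_mode md.scale M.scale_left_diff_distrib)

lemma vac_grade: "vac \<in> grade 0"
  by (simp add: grade_def degree_vac)

text \<open>
  Eigenvectors of \<open>D\<close> with distinct eigenvalues are independent. This separates the vacuum vector from
  submodules that live in positive degrees, and negative degrees from the whole module.
\<close>

lemma grade_independent: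
  assumes x: "x \<in> M.span (\<Union>s\<in>{r..}. grade s)" and t: "x \<in> grade t" "t < r"
  shows "x = 0"
proof -
  have "\<exists>A g. finite A \<and> A \<subseteq> {r..} \<and> (\<forall>s. g s \<in> grade s) \<and> (\<forall>s. s \<notin> A \<longrightarrow> g s = 0) \<and> x = (\<Sum>s\<in>A. g s)"
    using x
  proof (induction x rule: M.span_induct_alt)
    case base
    show ?case
      by (intro exI[of _ "{}"] exI[of _ "\<lambda>_. 0"]) (auto simp: M.subspace_0[OF subspace_grade])
  next
    case (step c z y)
    then obtain s0 where s0: "s0 \<ge> r" "z \<in> grade s0" by auto
    obtain A g where A: "finite A" "A \<subseteq> {r..}" and g: "\<And>s. g s \<in> grade s"
      and out: "\<And>s. s \<notin> A \<Longrightarrow> g s = 0" and y: "y = (\<Sum>s\<in>A. g s)"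
      using step(2) by blast
    \<comment> \<open>Adding \<open>c *v z\<close> changes only the component of degree \<open>s0\<close>.\<close>
    define g' where "g' s = g s + (if s = s0 then c *v z else 0)" for s
    have "(\<Sum>s\<in>insert s0 A. g' s) = (\<Sum>s\<in>insert s0 A. g s) + c *v z"
      unfolding g'_def sum.distrib using A(1) by simp
    also have "(\<Sum>s\<in>insert s0 A. g s) = y"
      unfolding y by (rule sum.mono_neutral_right) (use A out in auto)
    finally have "c *v z + y = (\<Sum>s\<in>insert s0 A. g' s)" by (simp add: add.commute)
    moreover have "g' s \<in> grade s" for s
      unfolding g'_def using g s0(2) subspace_grade[of s]
      by (auto intro!: M.subspace_add M.subspace_scale simp: M.subspace_0)
    moreover have "g' s = 0" if "s \<notin> insert s0 A" for s using that out by (simp add: g'_def)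
    ultimately show ?case using A s0(1)
      by (intro exI[of _ "insert s0 A"] exI[of _ g']) auto
  qed
  then obtain A g where A: "finite A" "A \<subseteq> {r..}" and g: "\<And>s. g s \<in> grade s" and xs: "x = (\<Sum>s\<in>A. g s)"
    by blast
  define v where "v s = (if s = t then - x else g s)" for s
  have tA: "t \<notin> A" using A t by auto
  have "v t = 0"
  proof (rule M.joint_eigenvectors_independent[where T = "\<lambda>_::unit. D" and v = v and A = "insert t A"
        and wt = "\<lambda>s _. of_int s"])
    show "inj_on (\<lambda>s _. (of_int s :: complex)) (insert t A)" by (auto simp: inj_on_def fun_eq_iff)
    show "D (v s) = of_int s *v v s" for s
      using g[of s] t(1) by (auto simp: v_def grade_def D.neg)
    have "(\<Sum>s\<in>A. v s) = x" unfolding xs using tA by (intro sum.cong) (auto simp: v_def)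
    then show "(\<Sum>s\<in>insert t A. v s) = 0" using tA A(1) by (simp add: v_def)
  qed (use A degree_linear in auto)
  then show ?thesis by (simp add: v_def)
qed

text \<open>
  When \<open>w\<close> is killed by all positive modes, these words span the submodule generated by \<open>w\<close>: this is the
  part of the Poincare-Birkhoff-Witt theorem that is needed.
\<close>

inductive_set lowering_words :: "'v \<Rightarrow> 'v set" for w where
  start: "w \<in> lowering_words w"
| lower: "x \<in> lowering_words w \<Longrightarrow> n \<le> 0 \<Longrightarrow> md y n x \<in> lowering_words w"

lemma lower_span:
  assumes "x \<in> M.span (lowering_words w)" and "n \<le> 0"
  shows "md y n x \<in> M.span (lowering_words w)"
  using assms(1)
proof (induction x rule: M.span_induct_alt)
  case (step c x x')
  then show ?case using assms(2)
    by (auto simp: md.add md.scale intro!: M.span_add M.span_scale intro: M.span_base lower)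
qed (simp add: md.zero M.span_zero)

text \<open>
  Commuting a positive mode past a lowering mode leaves a mode whose index may have either sign: if it is
  positive the induction hypothesis applies, otherwise it extends the word.
\<close>

lemma raise_word:
  assumes w: "\<And>x n. n > 0 \<Longrightarrow> md x n w = 0" and "x \<in> lowering_words w" and "n > 0"
  shows "md y n x \<in> M.span (lowering_words w)"
  using assms(2,3)
proof (induction x arbitrary: y n rule: lowering_words.induct)
  case start
  then show ?case by (simp add: w M.span_zero)
next
  case (lower x m u)
  have "md u m (md y n x) \<in> M.span (lowering_words w)"
    by (rule lower_span[OF lower.IH[OF lower.prems] lower.hyps(2)])
  moreover have "md (bracket y u) (n + m) x \<in> M.span (lowering_words w)"
    using lower.IH M.span_base[OF lowering_words.lower[OF lower.hyps(1), of "n + m"]]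
    by (cases "n + m > 0") auto
  moreover have "c *v x \<in> M.span (lowering_words w)" for c
    using lower.hyps(1) by (intro M.span_scale M.span_base)
  ultimately show ?case
    unfolding mode_commute[of y n u m] by (auto intro!: M.span_add M.span_zero)
qed

lemma span_lowering_words_closed:
  assumes w: "\<And>x n. n > 0 \<Longrightarrow> md x n w = 0" and x: "x \<in> M.span (lowering_words w)"
  shows "md y n x \<in> M.span (lowering_words w)"
proof (cases "n > 0")
  case True
  from x show ?thesis
  proof (induction x rule: M.span_induct_alt)
    case (step c x x')
    then show ?case using raise_word[OF w step(1) True]
      by (auto simp: md.add md.scale intro!: M.span_add M.span_scale)
  qed (simp add: md.zero M.span_zero)
qed (use lower_span x in auto)

lemma lowering_words_grade:
  assumes "w \<in> grade r"
  shows "M.span (lowering_words w) \<subseteq> M.span (\<Union>s\<in>{r..}. grade s)"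
proof (rule M.span_mono)
  have "\<exists>s\<ge>r. x \<in> grade s" if "x \<in> lowering_words w" for x
    using that
  proof (induction rule: lowering_words.induct)
    case start
    show ?case using assms by auto
  next
    case (lower x n y)
    then obtain s where "s \<ge> r" "x \<in> grade s" by blast
    then show ?case using mode_grade lower(2) by (intro exI[of _ "s - n"]) auto
  qed
  then show "lowering_words w \<subseteq> (\<Union>s\<in>{r..}. grade s)" by fastforce
qed

lemma grade_negative:
  assumes "v \<in> grade t" and "t < 0"
  shows "v = 0"
proof -
  have "M.span (lowering_words vac) = UNIV"
    by (rule generated)
      (auto intro: span_lowering_words_closed M.span_base lowering_words.start simp: vac_annihilated)
  then have "v \<in> M.span (\<Union>s\<in>{0..}. grade s)"
    using lowering_words_grade[OF vac_grade] by blast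
  then show ?thesis using assms by (rule grade_independent)
qed

text \<open>
  The submodule generated by \<open>w\<close> lives in degrees at least \<open>r > 0\<close> and misses the vacuum vector.
\<close>

lemma singular_vector_zero:
  assumes w: "\<And>x n. n > 0 \<Longrightarrow> md x n w = 0" and r: "w \<in> grade r" "r > 0"
  shows "w = 0"
proof -
  have "M.span (lowering_words w) = {0} \<or> M.span (lowering_words w) = UNIV"
    by (rule irreducible) (auto intro: span_lowering_words_closed w)
  then show ?thesis
  proof
    assume "M.span (lowering_words w) = {0}"
    then show "w = 0" using M.span_base[OF lowering_words.start[of w]] by auto
  next
    assume "M.span (lowering_words w) = UNIV"
    then have "vac \<in> M.span (\<Union>s\<in>{r..}. grade s)" using lowering_words_grade[OF r(1)] by blast
    then have "vac = 0" using vac_grade r(2) by (rule grade_independent)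
    then show "w = 0" using vac_nonzero by simp
  qed
qed

section \<open>Integrability\<close>

text \<open>
  The mode commutes with \<open>e(-1)\<close> and kills the vacuum vector.
\<close>

lemma commuting_mode_kills_power:
  assumes "bracket c e = 0" and "B c e = 0" and "s \<ge> 0"
  shows "md c s ((md e (- 1) ^^ N) vac) = 0"
proof (induction N)
  case (Suc N)
  then show ?case by (simp add: mode_commute[of c s e "- 1"] assms mode_zero md.zero)
qed (simp add: vac_annihilated assms)

text \<open>
  For \<open>b\<close> in a weight space other than that of \<open>- n\<close>, the bracket \<open>bracket b e\<close> commutes with \<open>e\<close>, because
  \<open>n\<close> is long, and \<open>b(s)\<close> kills every power. For \<open>b\<close> of weight \<open>- n\<close>, moving \<open>b(1)\<close> through
  \<open>e(-1)\<^bsup>N+1\<^esup> \<one>\<close> gives the factor \<open>\<langle>e, b\<rangle> (N + 1) (k - N)\<close>, which vanishes for \<open>N = k\<close>.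
\<close>

lemma long_root_power_singular:
  assumes n: "n \<in> long_weights" and e: "e \<in> weight_space n" "e \<noteq> 0" and s: "s > 0"
  shows "md b s ((md e (- 1) ^^ Suc k) vac) = 0"
proof -
  have nr: "n \<in> root_weights" "n \<noteq> 0" using n by (auto simp: long_weights_def root_weights_def)
  let ?v = "\<lambda>N. (md e (- 1) ^^ N) vac"
  define h where "h = weight_dual n"
  have h: "h \<in> \<hh>" using weight_dual(1)[OF nr(1)] by (simp add: h_def)
  have he: "bracket h e = 2 *s e"
    using bracket_cartan_weight[OF h e(1)] weight_value_coroot_self[OF nr(1)] coroot_long[OF n]
    by (simp add: h_def)
  have Bhe: "B h e = 0"
    using form_orthogonal[of h 0 e n] h e nr by (simp add: weight_space_0)
  have ee: "bracket e e = 0" by (rule bracket_self)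
  have Bee: "B e e = 0"
  proof (rule form_orthogonal[OF e(1) e(1)])
    obtain j where "n j \<noteq> 0" using nr(2) by (auto simp: fun_eq_iff)
    then show "n + n \<noteq> 0" by (auto simp: fun_eq_iff)
  qed
  have h_pos: "md h s (?v N) = 0" if "s > 0" for s N
  proof (induction N)
    case (Suc N)
    have "md e (s - 1) (?v N) = 0"
      using commuting_mode_kills_power[OF ee Bee, of "s - 1" N] that by simp
    then show ?case
      using Suc by (simp add: mode_commute[of h s e "- 1"] he Bhe mode_scale md.zero)
  qed (use that in \<open>simp add: vac_annihilated\<close>)
  have h_0: "md h 0 (?v N) = (2 * of_nat N) *v ?v N" for N
  proof (induction N)
    case (Suc N)
    have "md h 0 (?v (Suc N)) = (2 * of_nat N) *v ?v (Suc N) + 2 *v ?v (Suc N)"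
      by (simp add: mode_commute[of h 0 e "- 1"] he Suc mode_scale md.scale)
    also have "\<dots> = (2 * of_nat (Suc N)) *v ?v (Suc N)"
      by (subst M.scale_left_distrib[symmetric]) (simp add: algebra_simps del: funpow.simps)
    finally show ?case .
  qed (simp add: vac_annihilated)
  have hom: "md b s (?v (Suc k)) = 0" if b: "b \<in> weight_space m" for b m
  proof (cases "m = - n")
    case False
    have "bracket e (bracket e b) = 0" using long_ad_twice_zero[OF n e(1) b False] .
    then have be: "bracket (bracket b e) e = 0"
      using bracket_antisym[of "bracket b e" e] bracket_antisym[of b e] by (simp add: bracket_simps)
    have Bbe: "B b e = 0" using form_orthogonal[OF b e(1)] False by (auto simp: add_eq_0_iff2)
    have Bbee: "B (bracket b e) e = 0" by (simp add: form_invariant ee form_simps)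
    have "md b s (?v N) = 0" for N
    proof (induction N)
      case (Suc N)
      have "md (bracket b e) (s - 1) (?v N) = 0"
        using commuting_mode_kills_power[OF be Bbee, of "s - 1" N] s by simp
      then show ?case using Suc by (simp add: mode_commute[of b s e "- 1"] Bbe md.zero)
    qed (use s in \<open>simp add: vac_annihilated\<close>)
    then show ?thesis .
  next
    case True
    have be: "bracket b e = - B e b *s h"
      using bracket_opposite_roots[OF nr(1) e(1), of b] b True bracket_antisym[of b e] by (simp add: h_def)
    show ?thesis
    proof (cases "s = 1")
      case True
      have "md b 1 (?v (Suc N)) = (B e b * (of_nat (Suc N) * (of_nat k - of_nat N))) *v ?v N" for N
      proof (induction N)
        case 0
        show ?case
          by (simp add: mode_commute[of b 1 e "- 1"] be mode_minus mode_scale vac_annihilated md.zero form_sym[of b])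
      next
        case (Suc N)
        let ?u = "?v (Suc N)"
        have u: "?v (Suc (Suc N)) = md e (- 1) ?u" "?u = md e (- 1) (?v N)" by simp_all
        have "md b 1 (md e (- 1) ?u) = md e (- 1) (md b 1 ?u) + md (bracket b e) 0 ?u + (B b e * of_nat k) *v ?u"
          by (subst mode_commute) simp
        also have "md e (- 1) (md b 1 ?u) = (B e b * (of_nat (Suc N) * (of_nat k - of_nat N))) *v ?u"
          unfolding Suc by (simp add: md.scale)
        also have "md (bracket b e) 0 ?u = (- B e b * (2 * of_nat (Suc N))) *v ?u"
          unfolding be by (simp only: mode_scale h_0 M.scale_scale)
        also have "B b e = B e b" by (rule form_sym)
        finally have "md b 1 (?v (Suc (Suc N))) = (B e b * (of_nat (Suc N) * (of_nat k - of_nat N))) *v ?u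
            + (- B e b * (2 * of_nat (Suc N))) *v ?u + (B e b * of_nat k) *v ?u"
          unfolding u(1) .
        also have "\<dots> = (B e b * (of_nat (Suc (Suc N)) * (of_nat k - of_nat (Suc N)))) *v ?v (Suc N)"
          unfolding M.scale_left_distrib[symmetric] by (simp add: algebra_simps del: funpow.simps)
        finally show ?case .
      qed
      from this[of k] True show ?thesis by simp
    next
      case False
      have "md b s (?v N) = 0" for N
      proof (induction N)
        case (Suc N)
        have "md h (s - 1) (?v N) = 0" using h_pos False s by simp
        then show ?case using Suc False
          by (simp add: mode_commute[of b s e "- 1"] be mode_minus mode_scale md.zero)
      qed (use s in \<open>simp add: vac_annihilated\<close>)
      then show ?thesis .
    qed
  qed
  have "b \<in> span (\<Union>m. weight_space m)" by (simp add: span_weight_spaces)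
  then show ?thesis
  proof (induction b rule: span_induct_alt)
    case (step c b b')
    then show ?case using hom by (auto simp: mode_add mode_scale simp del: funpow.simps)
  qed (simp add: mode_zero)
qed

lemma long_mode_nilpotent:
  assumes n: "n \<in> long_weights" and e: "e \<in> weight_space n"
  shows "\<exists>q. (md e (- 1) ^^ q) v = 0"
proof (cases "e = 0")
  case True
  then show ?thesis by (intro exI[of _ 1]) (simp add: mode_zero)
next
  case False
  have "(md e (- 1) ^^ N) vac \<in> grade (int N)" for N
  proof (induction N)
    case (Suc N)
    then show ?case using mode_grade[OF Suc, of e "- 1"] by (simp add: add.commute)
  qed (simp add: vac_grade)
  then have g: "(md e (- 1) ^^ Suc k) vac \<in> grade (int (Suc k))" .
  have "(md e (- 1) ^^ Suc k) vac = 0"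
    by (rule singular_vector_zero[OF long_root_power_singular[OF n e False] g]) simp_all
  moreover have "n \<noteq> 0" using n by (auto simp: long_weights_def root_weights_def)
  ultimately show ?thesis using root_vector_ad_nilpotent[OF e] by (metis mode_nilpotent)
qed

text \<open>
  For a long \<open>n\<close> with \<open>weight_value m (coroot n) = 1\<close>, the root string of \<open>m\<close> in the direction \<open>n\<close> consists of
  \<open>m - n\<close> and \<open>m\<close>. So \<open>y(0)\<close> and \<open>x(-1)\<close>, with \<open>y = bracket f x\<close>, span a two-dimensional
  representation of the triple of \<open>e(-1)\<close> and \<open>f(1)\<close>. Conjugation by \<open>exp e(-1)\<close> turns
  \<open>y(0)\<close> into \<open>y(0) + x(-1)\<close>, and conjugation by \<open>exp (- f(1))\<close> turns this into \<open>x(-1)\<close>.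
\<close>

lemma short_mode_nilpotent:
  assumes m: "m \<in> root_weights" "m \<notin> long_weights" and x: "x \<in> weight_space m"
  shows "\<exists>q. (md x (- 1) ^^ q) v = 0"
proof -
  obtain n where n: "n \<in> long_weights" and mn: "weight_value m (coroot n) = 1"
    using long_or_adjacent_to_long[OF m] by blast
  have nr: "n \<in> root_weights" "n \<noteq> 0" using n by (auto simp: long_weights_def root_weights_def)
  have nm: "m \<noteq> n" using m n by blast
  obtain e f where e: "e \<in> weight_space n" and f: "f \<in> weight_space (- n)" and ef: "bracket e f = coroot n"
    using exists_sl2_triple[OF nr(1)] by blast
  define y where "y = bracket f x"
  have y: "y \<in> weight_space (m - n)"
    using bracket_weight_space[OF f x] by (simp add: y_def)
  have ex: "bracket e x = 0"
  proof (rule ccontr)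
    assume nz: "bracket e x \<noteq> 0"
    have v3: "weight_value (n + m) (coroot n) = of_int 3"
      using mn weight_value_coroot_self[OF nr(1)] by (simp add: weight_value_simps)
    have "n + m \<noteq> 0"
    proof
      assume "n + m = 0"
      then show False using v3 by (simp add: weight_value_simps)
    qed
    then have "n + m \<in> root_weights" using nz bracket_weight_space[OF e x] by (auto simp: root_weights_def)
    from long_coroot_bound(1)[OF n this v3] show False by simp
  qed
  have fy: "bracket f y = 0"
    unfolding y_def
    by (rule long_ad_twice_zero[OF _ f x]) (use n nm in \<open>auto simp: long_weights_def neg_root_weight\<close>)
  have ey: "bracket e y = x"
    using bracket_derivation[of e f x] bracket_cartan_weight[OF coroot_in_cartan[OF nr(1)] x]
    by (simp add: y_def ef mn ex bracket_simps)
  have Bfx: "B f x = 0" using form_orthogonal[OF f x] nm by simp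
  have y_nil: "\<exists>q. (md y 0 ^^ q) v = 0" for v
    using nonneg_mode_nilpotent[OF y] nm by simp
  have e_nil: "\<exists>q. (md e (- 1) ^^ q) v = 0" for v by (rule long_mode_nilpotent[OF n e])
  have f_nil: "\<exists>q. (md (- f) 1 ^^ q) v = 0" for v
    using nonneg_mode_nilpotent[of "- f" "- n" 1] f nr(2) subspace_neg[OF subspace_weight_space] by simp
  have lin: "Vector_Spaces.linear scaleM scaleM (\<lambda>v. md y 0 v + md x (- 1) v)"
    "Vector_Spaces.linear scaleM scaleM (\<lambda>v. - md y 0 v)"
    by (unfold_locales; simp add: md.add md.scale M.scale_right_distrib)+
  have yx_nil: "\<exists>q. ((\<lambda>v. md y 0 v + md x (- 1) v) ^^ q) v = 0" for v
    by (rule locally_nilpotent_conjugate[OF mode_linear mode_linear mode_linear e_nil y_nil])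
      (simp_all add: mode_commute[of e "- 1"] ey ex mode_zero)
  have "\<exists>q. ((\<lambda>v. (md y 0 v + md x (- 1) v) + - md y 0 v) ^^ q) v = 0"
  proof (rule locally_nilpotent_conjugate[OF mode_linear lin f_nil yx_nil])
    have fy': "md f 1 (md y 0 v) = md y 0 (md f 1 v)" for v
      by (simp add: mode_commute[of f 1 y 0] fy mode_zero)
    show "md (- f) 1 (md y 0 v + md x (- 1) v) =
        (md y 0 (md (- f) 1 v) + md x (- 1) (md (- f) 1 v)) + - md y 0 v" for v
      by (simp add: mode_minus md.add md.neg fy' mode_commute[of f 1 x "- 1"] Bfx flip: y_def)
    show "md (- f) 1 (- md y 0 v) = - md y 0 (md (- f) 1 v)" for v
      by (simp add: mode_minus md.neg fy')
  qed
  moreover have "(\<lambda>v. (md y 0 v + md x (- 1) v) + - md y 0 v) = md x (- 1)" by auto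
  ultimately show ?thesis by simp
qed

lemma root_mode_nilpotent:
  assumes "m \<in> root_weights" and "x \<in> weight_space m"
  shows "\<exists>q. (md x (- 1) ^^ q) v = 0"
  using assms long_mode_nilpotent short_mode_nilpotent by blast

section \<open>Reflections of weight multiplicities\<close>

definition joint_space :: "('i \<Rightarrow> int) \<Rightarrow> int \<Rightarrow> 'v set" where
  "joint_space n r = {v. (\<forall>j. md (W j) 0 v = of_int (n j) *v v) \<and> D v = of_int r *v v}"

lemma subspace_joint_space: "M.subspace (joint_space n r)"
  by (auto simp: M.subspace_def joint_space_def md.add md.scale md.zero D.add D.scale D.zero
      M.scale_right_distrib mult.commute)

lemma mode_joint_space:
  assumes x: "x \<in> weight_space m" and v: "v \<in> joint_space n r"
  shows "md x s v \<in> joint_space (n + m) (r - s)"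
proof -
  have "md (W j) 0 (md x s v) = of_int ((n + m) j) *v md x s v" for j
    using x v by (simp add: joint_space_def weight_space_def mode_commute[of "W j" 0] mode_scale md.scale
        M.scale_left_distrib)
  moreover have "D (md x s v) = of_int (r - s) *v md x s v"
    using v by (simp add: joint_space_def degree_mode md.scale M.scale_left_diff_distrib)
  ultimately show ?thesis by (simp add: joint_space_def)
qed

lemma mode_pow_joint_space:
  assumes x: "x \<in> weight_space m" and v: "v \<in> joint_space n r"
  shows "(md x s ^^ N) v \<in> joint_space (\<lambda>j. n j + int N * m j) (r - int N * s)"
proof (induction N)
  case (Suc N)
  have "(\<lambda>j. n j + int N * m j) + m = (\<lambda>j. n j + int (Suc N) * m j)"
    "r - int N * s - s = r - int (Suc N) * s"
    by (auto simp: fun_eq_iff algebra_simps)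
  with mode_joint_space[OF x Suc, of s] show ?case by simp
qed (use v in simp)

lemma cartan_joint_space:
  assumes y: "y \<in> \<hh>" and v: "v \<in> joint_space n r"
  shows "md y 0 v = weight_value n y *v v"
proof -
  have "md y 0 v = (\<Sum>j\<in>UNIV. \<alpha> j y *v md (W j) 0 v)"
    by (subst cartan_expansion[OF y]) (simp only: mode_sum mode_scale)
  also have "\<dots> = weight_value n y *v v"
    using v by (simp add: joint_space_def weight_value_def M.scale_sum_left mult.commute)
  finally show ?thesis .
qed

lemma sl2_modes:
  assumes e: "e \<in> weight_space w" and f: "f \<in> weight_space (- w)" and h: "bracket e f = h" "weight_value w h = 2"
    and ne: "\<And>v. \<exists>q. (md e (- s) ^^ q) v = 0" and nf: "\<And>v. \<exists>q. (md f s ^^ q) v = 0"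
  shows "sl2_module scaleM (md e (- s)) (md f s) (\<lambda>v. md h 0 v - (of_int s * B e f * of_nat k) *v v)"
proof -
  have hh: "h \<in> \<hh>" using bracket_weight_space[OF e f] h by (simp add: weight_space_0)
  then have he: "bracket h e = 2 *s e" and hf: "bracket h f = - 2 *s f"
    using e f h by (simp_all add: bracket_cartan_weight weight_value_simps)
  show ?thesis
  proof unfold_locales
    fix v
    show "md e (- s) (md f s v) = md f s (md e (- s) v) + (md h 0 v - (of_int s * B e f * of_nat k) *v v)"
      by (simp add: mode_commute[of e "- s"] h)
    show "md h 0 (md e (- s) v) - (of_int s * B e f * of_nat k) *v md e (- s) v =
        md e (- s) (md h 0 v - (of_int s * B e f * of_nat k) *v v) + 2 *v md e (- s) v"
      by (simp add: mode_commute[of h 0] he mode_scale md.diff md.scale)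
    show "md h 0 (md f s v) - (of_int s * B e f * of_nat k) *v md f s v =
        md f s (md h 0 v - (of_int s * B e f * of_nat k) *v v) - 2 *v md f s v"
      by (simp add: mode_commute[of h 0] hf mode_minus mode_scale md.diff md.scale)
  qed (use ne nf in \<open>auto simp: md.add md.scale M.scale_right_distrib M.scale_right_diff_distrib mult.commute\<close>)
qed

text \<open>
  The Weyl group reflection of the triple \<open>e(-s)\<close>, \<open>f(s)\<close>, on whose semisimple element the central charge
  contributes the shift by \<open>s * B e f * k\<close>.
\<close>

lemma dim_reflection:
  assumes e: "e \<in> weight_space w" and f: "f \<in> weight_space (- w)" and h: "bracket e f = h" "weight_value w h = 2"
    and ne: "\<And>v. \<exists>q. (md e (- s) ^^ q) v = 0" and nf: "\<And>v. \<exists>q. (md f s ^^ q) v = 0"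
    and l: "weight_value n h - of_int s * B e f * of_nat k = of_int l"
  shows "M.dim (joint_space n r) = M.dim (joint_space (\<lambda>j. n j - l * w j) (r - l * s))"
    (is "M.dim ?X = M.dim ?Y")
proof -
  let ?h = "\<lambda>v. md h 0 v - (of_int s * B e f * of_nat k) *v v"
  interpret sl2_module scaleM "md e (- s)" "md f s" ?h
    by (rule sl2_modes[OF e f h ne nf])
  interpret op: sl2_module scaleM "md f s" "md e (- s)" "\<lambda>v. - ?h v" by (rule opposite)
  have hh: "h \<in> \<hh>" using bracket_weight_space[OF e f] h by (simp add: weight_space_0)
  have X: "?h v = of_int l *v v" if "v \<in> ?X" for v
    using cartan_joint_space[OF hh that] l by (simp flip: M.scale_left_diff_distrib)
  have wv: "weight_value (\<lambda>j. n j - l * w j) h = weight_value n h - 2 * of_int l"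
    using h(2) by (simp add: weight_value_def sum_subtractf algebra_simps flip: sum_distrib_left)
  have Y: "?h v = - of_int l *v v" if "v \<in> ?Y" for v
  proof -
    have eq: "weight_value n h - 2 * of_int l - of_int s * B e f * of_nat k = - of_int l"
      using l by (simp add: algebra_simps)
    have "?h v = (weight_value n h - 2 * of_int l - of_int s * B e f * of_nat k) *v v"
      using cartan_joint_space[OF hh that] unfolding wv by (simp only: M.scale_left_diff_distrib)
    then show ?thesis unfolding eq .
  qed
  show ?thesis
  proof (cases "l \<ge> 0")
    case True
    show ?thesis
    proof (rule dim_opposite_weight_spaces[of _ "nat l"])
      show "(md f s ^^ nat l) ` ?X \<subseteq> ?Y"
        using mode_pow_joint_space[OF f, of _ n r "nat l" s] True by auto
      show "(md e (- s) ^^ nat l) ` ?Y \<subseteq> ?X"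
        using mode_pow_joint_space[OF e, of _ "\<lambda>j. n j - l * w j" "r - l * s" "nat l" "- s"] True by auto
    qed (use X Y True subspace_joint_space in auto)
  next
    case False
    show ?thesis
    proof (rule op.dim_opposite_weight_spaces[of _ "nat (- l)"])
      show "(md e (- s) ^^ nat (- l)) ` ?X \<subseteq> ?Y"
        using mode_pow_joint_space[OF e, of _ n r "nat (- l)" "- s"] False by auto
      show "(md f s ^^ nat (- l)) ` ?Y \<subseteq> ?X"
        using mode_pow_joint_space[OF f, of _ "\<lambda>j. n j - l * w j" "r - l * s" "nat (- l)" s] False by auto
    qed (use X Y False subspace_joint_space in auto)
  qed
qed

text \<open>
  The reflection for \<open>s = 1\<close> followed by the one for \<open>s = 0\<close>.
\<close>

lemma dim_translation:
  assumes d: "B (E i) (F i) = of_int d" and p: "weight_value n (H i) = of_int p"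
  shows "M.dim (joint_space n r) =
    M.dim (joint_space (n(i := n i - d * int k)) (r - (p - d * int k)))"
proof -
  let ?w = "simple_weight i"
  define l where "l = p - d * int k"
  define n' where "n' = (\<lambda>j. n j - l * ?w j)"
  note ws = generators_weight_space(1)[of i] generators_weight_space(2)[of i]
  have wH: "weight_value ?w (H i) = 2" by (simp add: generator_brackets)
  have nz: "?w \<noteq> 0" "- ?w \<noteq> 0" using simple_weight_nonzero by auto
  note nil = nonneg_mode_nilpotent[OF ws(1) nz(1)] nonneg_mode_nilpotent[OF ws(2) nz(2)]
    root_mode_nilpotent[OF simple_weight_root ws(1)]
  have 1: "M.dim (joint_space n r) = M.dim (joint_space n' (r - l * 1))"
    unfolding n'_def
    by (rule dim_reflection[OF ws generator_brackets(3) wH]) (use nil p d in \<open>auto simp: l_def\<close>)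
  have p': "weight_value n' (H i) = of_int (p - 2 * l)"
    using p wH by (simp add: n'_def weight_value_def sum_subtractf algebra_simps flip: sum_distrib_left)
  have "M.dim (joint_space n' (r - l * 1)) =
      M.dim (joint_space (\<lambda>j. n' j - (p - 2 * l) * ?w j) (r - l * 1 - (p - 2 * l) * 0))"
    by (rule dim_reflection[OF ws generator_brackets(3) wH]) (use nil p' in auto)
  also have "(\<lambda>j. n' j - (p - 2 * l) * ?w j) = n(i := n i - d * int k)"
    by (auto simp: fun_eq_iff n'_def simple_weight_def l_def)
  finally show ?thesis using 1 by (simp add: l_def fun_upd_def)
qed

end

section \<open>Modes of an affine Lie algebra module\<close>

lemma poly_mapping_sum_singles: "p = (\<Sum>m\<in>Poly_Mapping.keys p. Poly_Mapping.single m (Poly_Mapping.lookup p m))"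
  by (rule poly_mapping_eqI) (auto simp: lookup_sum lookup_single when_def in_keys_iff)

lemma affine_decomposition:
  "x = (\<Sum>m\<in>Poly_Mapping.keys (fst x). loop_element (Poly_Mapping.lookup (fst x) m) m) +
    affine_scale scale (snd x) central_element"
proof -
  have pair: "(\<Sum>m\<in>A. loop_element (f m) m) = (\<Sum>m\<in>A. Poly_Mapping.single m (f m), 0)"
    for A and f :: "int \<Rightarrow> 'a"
    by (induction A rule: infinite_finite_induct) (simp_all add: loop_element_def zero_prod_def)
  have "Poly_Mapping.map (scale (snd x)) 0 = 0"
    by (rule poly_mapping_eqI) (simp add: Poly_Mapping.map.rep_eq)
  then show ?thesis
    unfolding pair by (cases x) (simp add: central_element_def affine_scale_def flip: poly_mapping_sum_singles)
qed

text \<open>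
  The hypotheses on zero arguments matter because the bracket is defined by sums over supports, in which a
  zero vector does not occur.
\<close>

lemma affine_bracket_loop_elements:
  assumes "bracket 0 y = 0" and "bracket x 0 = 0" and "B 0 y = 0" and "B x 0 = 0"
  shows "affine_bracket bracket B (loop_element x m) (loop_element y n) =
    loop_element (bracket x y) (m + n) +
    affine_scale scale (if m + n = 0 then of_int m * B x y else 0) central_element"
proof -
  have "Poly_Mapping.map (scale c) 0 = 0" for c
    by (rule poly_mapping_eqI) (simp add: Poly_Mapping.map.rep_eq)
  then show ?thesis
    using assms by (auto simp: affine_bracket_def loop_element_def affine_scale_def central_element_def)
qed

text \<open>
  The loop elements and the central element span, so a subspace stable under all modes is a submodule, the
  central element acting by a scalar.
\<close>

lemma (in normalized_cartan_data) vacuum_module_modes: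
  fixes scaleM :: "complex \<Rightarrow> 'v::ab_group_add \<Rightarrow> 'v" and \<rho> :: "'g affine \<Rightarrow> 'v \<Rightarrow> 'v"
  assumes L: "is_L_k_0 scale bracket B (of_nat k) scaleM \<rho> vac" and D: "is_L0 scaleM \<rho> vac D"
  shows "vacuum_module scale bracket \<hh> \<alpha> E F H W B scaleM (mode \<rho>) k vac D"
proof -
  have lm: "lie_module (affine_scale scale) (affine_bracket bracket B) scaleM \<rho>"
    using L by (simp add: is_L_k_0_def)
  interpret A: lie_module "affine_scale scale" "affine_bracket bracket B" scaleM \<rho> by (rule lm)
  interpret l: Vector_Spaces.linear "affine_scale scale" scaleM "\<lambda>x. \<rho> x v" for v
    by (rule A.action_linear_left)
  have L': "A.irreducible_module" "A.generated_by vac"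
    "\<And>v. \<rho> central_element v = scaleM (of_nat k) v" "\<And>a n. n \<ge> 0 \<Longrightarrow> mode \<rho> a n vac = 0"
    using L by (simp_all add: is_L_k_0_def)
  have closed: "A.submodule S" if S: "A.M.subspace S" "\<And>x n v. v \<in> S \<Longrightarrow> mode \<rho> x n v \<in> S" for S
    unfolding A.submodule_def
  proof (intro conjI allI ballI)
    fix x v assume v: "v \<in> S"
    have "\<rho> x v = (\<Sum>m\<in>Poly_Mapping.keys (fst x). mode \<rho> (Poly_Mapping.lookup (fst x) m) m v) +
        scaleM (snd x) (scaleM (of_nat k) v)"
      by (subst affine_decomposition[of x scale]) (simp only: l.add l.sum l.scale L'(3))
    also have "\<dots> \<in> S"
      using S v by (intro A.M.subspace_add A.M.subspace_sum A.M.subspace_scale)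
    finally show "\<rho> x v \<in> S" .
  qed (rule S(1))
  show ?thesis
  proof unfold_locales
    fix x y :: 'g and m n :: int and v :: 'v and c
    have "loop_element (x + y) n = loop_element x n + loop_element y n"
      by (simp add: loop_element_def single_add)
    then show "mode \<rho> (x + y) n v = mode \<rho> x n v + mode \<rho> y n v" by (simp only: l.add)
    have "loop_element (c *s x) n = affine_scale scale c (loop_element x n)"
      by (simp add: loop_element_def affine_scale_def)
    then show "mode \<rho> (c *s x) n v = scaleM c (mode \<rho> x n v)" by (simp only: l.scale)
    have "\<rho> (affine_bracket bracket B (loop_element x m) (loop_element y n)) v =
        mode \<rho> (bracket x y) (m + n) v + (if m + n = 0 then scaleM (of_int m * B x y * of_nat k) v else 0)"
      by (subst affine_bracket_loop_elements[where scale = scale])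
        (simp_all add: bracket_simps form_simps l.add l.scale L'(3))
    then show "mode \<rho> x m (mode \<rho> y n v) = mode \<rho> y n (mode \<rho> x m v) + mode \<rho> (bracket x y) (m + n) v +
        (if m + n = 0 then scaleM (of_int m * B x y * of_nat k) v else 0)"
      by (simp add: A.action_bracket algebra_simps)
    interpret r: Vector_Spaces.linear scaleM scaleM "mode \<rho> x n" by (rule A.action_linear_right)
    show "mode \<rho> x n (v + w) = mode \<rho> x n v + mode \<rho> x n w" for w by (rule r.add)
    show "mode \<rho> x n (scaleM c v) = scaleM c (mode \<rho> x n v)" by (rule r.scale)
    show "D (mode \<rho> x n v) = mode \<rho> x n (D v) - scaleM (of_int n) (mode \<rho> x n v)"
      using D by (simp add: is_L0_def algebra_simps)
  next
    fix S :: "'v set"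
    assume "A.M.subspace S" "\<And>x n v. v \<in> S \<Longrightarrow> mode \<rho> x n v \<in> S"
    note S = closed[OF this]
    show "S = {0} \<or> S = UNIV" using L'(1) S by (simp add: A.irreducible_module_def)
    show "S = UNIV" if "vac \<in> S" using L'(2) S that by (simp add: A.generated_by_def)
  next
    interpret D: Vector_Spaces.linear scaleM scaleM D using D by (simp add: is_L0_def)
    show "D (v + w) = D v + D w" "D (scaleM c v) = scaleM c (D v)" for v w c
      by (rule D.add, rule D.scale)
    show "D vac = 0" using D by (simp add: is_L0_def)
    show "\<exists>v::'v. v \<noteq> 0" using L'(1) by (simp add: A.irreducible_module_def)
  qed (use L'(4) in auto)
qed

section \<open>The identity for the character\<close>

theorem proposition2p4:
  fixes scale :: "complex \<Rightarrow> 'g::ab_group_add \<Rightarrow> 'g"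
    and bracket :: "'g \<Rightarrow> 'g \<Rightarrow> 'g"
    and \<hh> :: "'g set"
    and B :: "'g \<Rightarrow> 'g \<Rightarrow> complex"
    and \<alpha> :: "'i::finite \<Rightarrow> 'g \<Rightarrow> complex"
    and E F H W :: "'i \<Rightarrow> 'g"
    and k :: nat
    and scaleM :: "complex \<Rightarrow> 'v::ab_group_add \<Rightarrow> 'v"
    and \<rho> :: "'g affine \<Rightarrow> 'v \<Rightarrow> 'v"
    and vac :: 'v
    and D :: "'v \<Rightarrow> 'v"
    and a :: "'i \<Rightarrow> 'i \<Rightarrow> int"
    and d :: "'i \<Rightarrow> int"
    and A :: "('i \<Rightarrow> int) \<Rightarrow> complex fps"
  assumes "simple_lie_algebra scale bracket"
    and "lie_algebra.cartan_subalgebra scale bracket \<hh>"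
    and "complex_lie_algebra.normalized_killing_form scale bracket \<hh> B"
    and "lie_algebra.simple_roots scale bracket \<hh> \<alpha>"
    and "lie_algebra.chevalley_generators scale bracket \<hh> \<alpha> E F H"
    and "lie_algebra.fundamental_coweights \<hh> \<alpha> W"
    and "k > 0"
    and "is_L_k_0 scale bracket B (of_nat k) scaleM \<rho> vac"
    and "is_L0 scaleM \<rho> vac D"
    and "\<And>i j. a i j = the_int (\<alpha> i (H j))"
    and "\<And>i. d i = the_int (2 / lie_algebra.dual_form B \<hh> (\<alpha> i) (\<alpha> i))"
    and "\<And>n. A n = character scaleM \<rho> W D n"
  shows "(\<forall>n i. fps_to_fls (A n) =
            fps_to_fls (A (n(i := n i - d i * int k))) *
              fls_X_intpow (- (d i * int k) + (\<Sum>m\<in>UNIV. a m i * n m))) \<and>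
         (complex_lie_algebra.simply_laced scale bracket B \<hh> \<longrightarrow>
          (\<forall>n i. fps_to_fls (A n) =
            fps_to_fls (A (n(i := n i - int k))) *
              fls_X_intpow (- int k + (\<Sum>j\<in>UNIV. a j i * n j))))"
proof -
  interpret simple_lie_algebra scale bracket by (rule assms(1))
  interpret complex_lie_algebra scale bracket by unfold_locales
  interpret normalized_cartan_data scale bracket \<hh> \<alpha> E F H W B
    using assms(2-6) by unfold_locales
  interpret vacuum_module scale bracket \<hh> \<alpha> E F H W B scaleM "mode \<rho>" k vac D
    by (rule vacuum_module_modes[OF assms(8,9)])
  have coeff: "fls_nth (fps_to_fls (A n)) r = of_nat (M.dim (joint_space n r))" for n r
  proof (cases "r < 0")
    case True
    have "joint_space n r \<subseteq> M.span {}"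
      using grade_negative[OF _ True] by (auto simp: joint_space_def grade_def)
    then have "M.dim (joint_space n r) = 0" using M.dim_le_card[of _ "{}"] by simp
    then show ?thesis using True by (simp add: fps_to_fls_nth)
  next
    case False
    then show ?thesis
      by (simp add: fps_to_fls_nth assms(12) character_def joint_eigenspace_def joint_space_def)
  qed
  have a: "weight_value n (H i) = of_int (\<Sum>m\<in>UNIV. a m i * n m)" for n i
  proof -
    have "\<alpha> m (H i) = of_int (a m i)" for m
    proof -
      obtain x where "x \<in> weight_space (simple_weight m)" "x \<noteq> 0"
        using root_weight_vector[OF simple_weight_root] by blast
      then obtain z where "weight_value (simple_weight m) (coroot (simple_weight i)) = of_int z"
        using coroot_integral[OF simple_weight_root] by blast
      then show ?thesis by (simp add: assms(10) chevalley_coroot(1))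
    qed
    then show ?thesis by (simp add: weight_value_def mult.commute)
  qed
  have dual: "dual_form B \<hh> (\<alpha> i) (\<alpha> i) = of_real (sq_length (simple_weight i))" for i
    using dual_form_eq[OF simple_weight_root, of i] by (simp add: weight_value_simple[abs_def])
  have d: "B (E i) (F i) = of_int (d i)" for i
  proof -
    obtain z where z: "of_real (2 / sq_length (simple_weight i)) = (of_int z :: complex)"
      using inverse_length_integral[OF simple_weight_root] by blast
    then have "d i = z" by (simp add: assms(11) dual)
    with z show ?thesis by (simp add: chevalley_coroot(2))
  qed
  have main: "fps_to_fls (A n) = fps_to_fls (A (n(i := n i - d i * int k))) *
      fls_X_intpow (- (d i * int k) + (\<Sum>m\<in>UNIV. a m i * n m))" for n i
  proof (rule fls_eqI)
    fix r
    let ?p = "\<Sum>m\<in>UNIV. a m i * n m"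
    have "r - (?p - d i * int k) = r + - (- (d i * int k) + ?p)" by simp
    then show "fls_nth (fps_to_fls (A n)) r = fls_nth (fps_to_fls (A (n(i := n i - d i * int k))) *
        fls_X_intpow (- (d i * int k) + ?p)) r"
      using dim_translation[OF d a, of n r i]
      by (simp only: coeff fls_X_intpow_times_conv_shift fls_shift_nth)
  qed
  have d1: "d i = 1" if "simply_laced B \<hh>" for i
  proof -
    obtain n where n: "n \<in> long_weights" using exists_long_weight by blast
    have roots: "weight_value n \<in> roots \<hh>" "weight_value (simple_weight i) \<in> roots \<hh>"
      using n simple_weight_root by (auto simp: roots_eq long_weights_def)
    then have "dual_form B \<hh> (weight_value (simple_weight i)) (weight_value (simple_weight i)) =
        dual_form B \<hh> (weight_value n) (weight_value n)"
      using that unfolding simply_laced_def by blast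
    then have "dual_form B \<hh> (\<alpha> i) (\<alpha> i) = 2"
      using n dual_form_eq[of n] by (simp add: weight_value_simple[abs_def] long_weights_def)
    then show ?thesis using the_int_of_int[of 1] by (simp add: assms(11))
  qed
  show ?thesis
  proof (intro conjI impI allI)
    show "fps_to_fls (A n) = fps_to_fls (A (n(i := n i - int k))) *
        fls_X_intpow (- int k + (\<Sum>j\<in>UNIV. a j i * n j))"
      if "simply_laced B \<hh>" for n i
      using main[of n i] unfolding d1[OF that] mult_1 .
  qed (rule main)
qed

end
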